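(* Let $I\subset R$ be a bihomogeneous ideal and let $(a,b)$ be an admissible bidegree for $I$ such that $h=x_0$ is an admissible linear form for $(a,b)$. Then, for every monomial order on $k[\frac{x_1}{x_0},\dots,\frac{x_n}{x_0}]$, the algorithm FGLM, applied to the multiplication matrices $\mathcal M_{x_1/x_0},\dots,\mathcal M_{x_n/x_0}$ and computing linear relations between (products of) these matrices, recovers a Gröbner basis, with respect to that order, of the ideal $(J_b\otimes_{R_X}R_{X,x_0})_0\subset k[\frac{x_1}{x_0},\dots,\frac{x_n}{x_0}]$.
   Context: Let $k$ be a field and $R=k[x_0,\dots,x_n,y_0,\dots,y_m]$ with the $\mathbb{Z}^2$-grading $\deg(x_i)=(1,0)$, $\deg(y_j)=(0,1)$; put $R_X=k[x_0,\dots,x_n]$ and $\mathfrak m_y=\langle y_0,\dots,y_m\rangle$. An ideal is bihomogeneous if it is generated by bihomogeneous elements. The subscript $a,b$ denotes the bidegree-$(a,b)$ component, and $\mathrm{HF}_{R/I}(a,b)=\dim_k(R/I)_{a,b}$. Admissible: a bidegree $(a,b)\in\mathbb{Z}_{\ge0}^2$ is admissible for $I$ if $I$ is generated in bidegrees componentwise $\le(a,b)$ and there is a polynomial $h$ of bidegree $(1,0)$ with $\mathrm{HF}_{R/I}(a,b)=\mathrm{HF}_{R/I}(a+1,b)$ and $\mathrm{HF}_{R/(I,h)}(a,b)=0$; such an $h$ is called an admissible linear form for $(a,b)$. $J_b:=(I:\mathfrak m_y^b)\cap R_X=\mathrm{Ann}_{R_X}\big(\bigoplus_{a'}(R/I)_{a',b}\big)$.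 $R_{X,x_0}$ is the localization of $R_X$ at the powers of $x_0$; its degree-zero part is $(R_{X,x_0})_0=k[\frac{x_1}{x_0},\dots,\frac{x_n}{x_0}]$, and $(J_b\otimes_{R_X}R_{X,x_0})_0$ is the degree-zero part of the extension of $J_b$ to $R_{X,x_0}$. Multiplication matrices: for $g\in R_{d,0}$, let $\bar m_g:(R/I)_{a,b}\to(R/I)_{a+d,b}$, $[f]\mapsto[gf]$. The map $\bar m_{x_0}$ is invertible. $\mathcal M_{x_i/x_0}$ is the matrix of $\bar m_{x_0}^{-1}\circ\bar m_{x_i}$ in a fixed basis $B$ of the $k$-vector space $(R/I)_{a,b}$. These matrices commute pairwise. FGLM for commuting square matrices $M_1,\dots,M_n$ over $k$ and a monomial order on $k[z_1,\dots,z_n]$ (here $z_i=x_i/x_0$): for a monomial $u=z^\alpha$ put $M^u=M_1^{\alpha_1}\cdots M_n^{\alpha_n}$. Start with the candidate list $L=\{1\}$, $S=\emptyset$, $G=\emptyset$. While $L\neq\emptyset$: remove the smallest monomial $u$ from $L$; if $u$ is divisible by the leading monomial of an element of $G$, discard it; otherwise, if $M^u=\sum_{v\in S}c_vM^v$ for some $c_v\in k$, add $u-\sum_{v\in S}c_v v$ to $G$; otherwise add $u$ to $S$ and add $z_1u,\dots,z_nu$ to $L$. Output $G$. *)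

theory Defs
  imports
    "HOL-Algebra.Ideal_Product"
    "HOL-Algebra.QuotRing"
    "HOL-Library.Poly_Mapping"
    "HOL-Library.While_Combinator"
    "HOL-Computational_Algebra.Fraction_Field"
    "Jordan_Normal_Form.VS_Connect"
begin

hide_const (open) Multiset.mult

text \<open>
  An element of \<open>'v \<Rightarrow>\<^sub>0 nat\<close> is a monomial, written additively as its exponent vector (so that
  \<open>0\<close> is the monomial 1), and \<open>('v, 'k) mpoly\<close> is the polynomial ring in all variables from \<open>'v\<close>.
  Polynomial rings in finitely many variables are carriers inside it.
\<close>

type_synonym ('v, 'k) mpoly = "('v \<Rightarrow>\<^sub>0 nat) \<Rightarrow>\<^sub>0 'k"

definition poly_ring :: "'v set \<Rightarrow> ('v, 'k::comm_ring_1) mpoly ring" where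
  "poly_ring V = \<lparr>carrier = {f. \<forall>t\<in>Poly_Mapping.keys f. Poly_Mapping.keys t \<subseteq> V},
     mult = (*), one = 1, zero = 0, add = (+)\<rparr>"

abbreviation monom_poly :: "('v \<Rightarrow>\<^sub>0 nat) \<Rightarrow> ('v, 'k::comm_ring_1) mpoly" where
  "monom_poly t \<equiv> Poly_Mapping.single t 1"

abbreviation const_poly :: "'k \<Rightarrow> ('v, 'k::comm_ring_1) mpoly" where
  "const_poly c \<equiv> Poly_Mapping.single 0 c"


subsection \<open>The bigraded polynomial ring\<close>

datatype var = X nat | Y nat

text \<open>
  The linear order on variables has no mathematical role here: the library needs one to
  recognise \<open>(var, 'k) mpoly\<close> as an integral domain, hence to form its fraction field.
\<close>

fun var_code :: "var \<Rightarrow> nat" where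
  "var_code (X i) = 2 * i"
| "var_code (Y j) = 2 * j + 1"

lemma var_code_inject: "var_code u = var_code v \<Longrightarrow> u = v"
  by (cases u; cases v) (simp_all, presburger+)

instantiation var :: linorder
begin

definition less_eq_var :: "var \<Rightarrow> var \<Rightarrow> bool" where
  "less_eq_var u v \<longleftrightarrow> var_code u \<le> var_code v"

definition less_var :: "var \<Rightarrow> var \<Rightarrow> bool" where
  "less_var u v \<longleftrightarrow> var_code u < var_code v"

instance
  by standard (auto simp: less_eq_var_def less_var_def intro: var_code_inject)

end

abbreviation var_poly :: "var \<Rightarrow> (var, 'k::comm_ring_1) mpoly" where
  "var_poly v \<equiv> monom_poly (Poly_Mapping.single v 1)"

definition bi_ring :: "nat \<Rightarrow> nat \<Rightarrow> (var, 'k::field) mpoly ring" where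
  "bi_ring n m = poly_ring (X ` {..n} \<union> Y ` {..m})"

definition x_ring :: "nat \<Rightarrow> (var, 'k::field) mpoly ring" where
  "x_ring n = poly_ring (X ` {..n})"

definition xdeg :: "(var \<Rightarrow>\<^sub>0 nat) \<Rightarrow> nat" where
  "xdeg t = (\<Sum>v\<in>Poly_Mapping.keys t. case v of X _ \<Rightarrow> Poly_Mapping.lookup t v | Y _ \<Rightarrow> 0)"

definition ydeg :: "(var \<Rightarrow>\<^sub>0 nat) \<Rightarrow> nat" where
  "ydeg t = (\<Sum>v\<in>Poly_Mapping.keys t. case v of X _ \<Rightarrow> 0 | Y _ \<Rightarrow> Poly_Mapping.lookup t v)"

definition bihom_part :: "nat \<Rightarrow> nat \<Rightarrow> nat \<Rightarrow> nat \<Rightarrow> (var, 'k::field) mpoly set" where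
  "bihom_part n m a b =
     {f \<in> carrier (bi_ring n m). \<forall>t\<in>Poly_Mapping.keys f. xdeg t = a \<and> ydeg t = b}"

definition bihomogeneous_ideal :: "nat \<Rightarrow> nat \<Rightarrow> (var, 'k::field) mpoly set \<Rightarrow> bool" where
  "bihomogeneous_ideal n m I \<longleftrightarrow> ideal I (bi_ring n m) \<and>
     (\<exists>F. (\<forall>f\<in>F. \<exists>c d. f \<in> bihom_part n m c d) \<and> I = genideal (bi_ring n m) F)"

definition generated_up_to :: "nat \<Rightarrow> nat \<Rightarrow> (var, 'k::field) mpoly set \<Rightarrow> nat \<Rightarrow> nat \<Rightarrow> bool" where
  "generated_up_to n m I a b \<longleftrightarrow>
     (\<exists>F. (\<forall>f\<in>F. \<exists>c\<le>a. \<exists>d\<le>b. f \<in> bihom_part n m c d) \<and> I = genideal (bi_ring n m) F)"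


subsection \<open>Graded pieces of the quotient and admissible bidegrees\<close>

text \<open>
  The \<open>k\<close>-vector space \<open>(R/I)\<^bsub>a,b\<^esub>\<close>, consisting of the cosets of bihomogeneous polynomials.
  The fields \<^const>\<open>mult\<close> and \<^const>\<open>one\<close> of the record are irrelevant for a vector space.
\<close>

definition quot_part ::
  "nat \<Rightarrow> nat \<Rightarrow> (var, 'k::field) mpoly set \<Rightarrow> nat \<Rightarrow> nat \<Rightarrow> ('k, (var, 'k) mpoly set) module" where
  "quot_part n m I a b = (let R = bi_ring n m; Q = R Quot I in
     \<lparr>carrier = (\<lambda>f. I +>\<^bsub>R\<^esub> f) ` bihom_part n m a b,
      mult = mult Q, one = one Q, zero = zero Q, add = add Q,
      smult = (\<lambda>c C. (I +>\<^bsub>R\<^esub> const_poly c) \<otimes>\<^bsub>Q\<^esub> C)\<rparr>)"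

definition HF :: "nat \<Rightarrow> nat \<Rightarrow> (var, 'k::field) mpoly set \<Rightarrow> nat \<Rightarrow> nat \<Rightarrow> nat" where
  "HF n m I a b = vectorspace.dim class_ring (quot_part n m I a b)"

definition admissible_linear_form ::
  "nat \<Rightarrow> nat \<Rightarrow> (var, 'k::field) mpoly set \<Rightarrow> nat \<Rightarrow> nat \<Rightarrow> (var, 'k) mpoly \<Rightarrow> bool" where
  "admissible_linear_form n m I a b h \<longleftrightarrow>
     h \<in> bihom_part n m 1 0 \<and>
     HF n m I a b = HF n m I (a + 1) b \<and>
     HF n m (genideal (bi_ring n m) (I \<union> {h})) a b = 0"

definition admissible :: "nat \<Rightarrow> nat \<Rightarrow> (var, 'k::field) mpoly set \<Rightarrow> nat \<Rightarrow> nat \<Rightarrow> bool" where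
  "admissible n m I a b \<longleftrightarrow>
     generated_up_to n m I a b \<and> (\<exists>h. admissible_linear_form n m I a b h)"


subsection \<open>The ideal \<open>J\<^sub>b\<close> and its dehomogenization\<close>

definition y_ideal :: "nat \<Rightarrow> nat \<Rightarrow> (var, 'k::field) mpoly set" where
  "y_ideal n m = genideal (bi_ring n m) ((\<lambda>j. var_poly (Y j)) ` {..m})"

definition ideal_power :: "('r, 's) ring_scheme \<Rightarrow> 'r set \<Rightarrow> nat \<Rightarrow> 'r set" where
  "ideal_power R J b = (ideal_prod R J ^^ b) (carrier R)"

definition ideal_colon :: "('r, 's) ring_scheme \<Rightarrow> 'r set \<Rightarrow> 'r set \<Rightarrow> 'r set" where
  "ideal_colon R I K = {f \<in> carrier R. \<forall>g\<in>K. f \<otimes>\<^bsub>R\<^esub> g \<in> I}"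

definition J_ideal :: "nat \<Rightarrow> nat \<Rightarrow> (var, 'k::field) mpoly set \<Rightarrow> nat \<Rightarrow> (var, 'k) mpoly set" where
  "J_ideal n m I b =
     ideal_colon (bi_ring n m) I (ideal_power (bi_ring n m) (y_ideal n m) b) \<inter> carrier (x_ring n)"

definition x0_localization :: "nat \<Rightarrow> (var, 'k::field) mpoly fract ring" where
  "x0_localization n =
     \<lparr>carrier = {Fract f (var_poly (X 0) ^ d) | f d. f \<in> carrier (x_ring n)},
      mult = (*), one = 1, zero = 0, add = (+)\<rparr>"

definition x0_localization_deg0 :: "nat \<Rightarrow> (var, 'k::field) mpoly fract set" where
  "x0_localization_deg0 n =
     {Fract f (var_poly (X 0) ^ d) | f d.
        f \<in> carrier (x_ring n) \<and> (\<forall>t\<in>Poly_Mapping.keys f. xdeg t = d)}"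

text \<open>
  The polynomial ring \<open>k[z\<^sub>1,\<dots>,z\<^sub>n]\<close> is \<^term>\<open>poly_ring {1..n}\<close>; the following evaluation at
  \<open>z\<^sub>i = x\<^sub>i/x\<^sub>0\<close> identifies it with the degree-zero part of the localization.
\<close>

definition z_ring :: "nat \<Rightarrow> (nat, 'k::field) mpoly ring" where
  "z_ring n = poly_ring {1..n}"

definition z_eval :: "(nat, 'k::field) mpoly \<Rightarrow> (var, 'k) mpoly fract" where
  "z_eval p = (\<Sum>t\<in>Poly_Mapping.keys p. Fract (const_poly (Poly_Mapping.lookup p t)) 1 *
     (\<Prod>i\<in>Poly_Mapping.keys t. Fract (var_poly (X i)) (var_poly (X 0)) ^ Poly_Mapping.lookup t i))"

definition affine_ideal :: "nat \<Rightarrow> nat \<Rightarrow> (var, 'k::field) mpoly set \<Rightarrow> nat \<Rightarrow> (nat, 'k) mpoly set" where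
  "affine_ideal n m I b = {p \<in> carrier (z_ring n).
     z_eval p \<in> genideal (x0_localization n) ((\<lambda>f. Fract f 1) ` J_ideal n m I b)
                \<inter> x0_localization_deg0 n}"


subsection \<open>Multiplication matrices\<close>

definition mult_map ::
  "nat \<Rightarrow> nat \<Rightarrow> (var, 'k::field) mpoly set \<Rightarrow> (var, 'k) mpoly \<Rightarrow> (var, 'k) mpoly set \<Rightarrow> (var, 'k) mpoly set" where
  "mult_map n m I g C = (I +>\<^bsub>bi_ring n m\<^esub> g) \<otimes>\<^bsub>bi_ring n m Quot I\<^esub> C"

definition coords :: "('k::field, 'v, 'c) module_scheme \<Rightarrow> 'v list \<Rightarrow> 'v \<Rightarrow> 'k vec" where
  "coords V B v = (THE c. c \<in> carrier_vec (length B) \<and>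
     (\<Oplus>\<^bsub>V\<^esub>i\<in>{..<length B}. c $ i \<odot>\<^bsub>V\<^esub> (B ! i)) = v)"

definition matrix_of_map :: "('k::field, 'v, 'c) module_scheme \<Rightarrow> 'v list \<Rightarrow> ('v \<Rightarrow> 'v) \<Rightarrow> 'k mat" where
  "matrix_of_map V B T = mat (length B) (length B) (\<lambda>(i, j). coords V B (T (B ! j)) $ i)"

definition mult_matrix ::
  "nat \<Rightarrow> nat \<Rightarrow> (var, 'k::field) mpoly set \<Rightarrow> nat \<Rightarrow> nat \<Rightarrow> (var, 'k) mpoly set list \<Rightarrow> nat \<Rightarrow> 'k mat" where
  "mult_matrix n m I a b B i =
     matrix_of_map (quot_part n m I a b) B
       (inv_into (carrier (quot_part n m I a b)) (mult_map n m I (var_poly (X 0)))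
        \<circ> mult_map n m I (var_poly (X i)))"


subsection \<open>Monomial orders and Groebner bases\<close>

definition z_monomials :: "nat \<Rightarrow> (nat \<Rightarrow>\<^sub>0 nat) set" where
  "z_monomials n = {t. Poly_Mapping.keys t \<subseteq> {1..n}}"

text \<open>\<^prop>\<open>(s, t) \<in> r\<close> means that \<open>s\<close> is at most \<open>t\<close>.\<close>

definition monomial_order :: "nat \<Rightarrow> (nat \<Rightarrow>\<^sub>0 nat) rel \<Rightarrow> bool" where
  "monomial_order n r \<longleftrightarrow> well_order_on (z_monomials n) r \<and>
     (\<forall>s t. \<forall>u\<in>z_monomials n. (s, t) \<in> r \<longrightarrow> (s + u, t + u) \<in> r)"

definition lead_monomial :: "(nat \<Rightarrow>\<^sub>0 nat) rel \<Rightarrow> (nat, 'k::field) mpoly \<Rightarrow> (nat \<Rightarrow>\<^sub>0 nat)" where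
  "lead_monomial r p =
     (THE t. t \<in> Poly_Mapping.keys p \<and> (\<forall>s\<in>Poly_Mapping.keys p. (s, t) \<in> r))"

definition lead_ideal ::
  "nat \<Rightarrow> (nat \<Rightarrow>\<^sub>0 nat) rel \<Rightarrow> (nat, 'k::field) mpoly set \<Rightarrow> (nat, 'k) mpoly set" where
  "lead_ideal n r F = genideal (z_ring n) {monom_poly (lead_monomial r f) | f. f \<in> F \<and> f \<noteq> 0}"

definition groebner_basis ::
  "nat \<Rightarrow> (nat \<Rightarrow>\<^sub>0 nat) rel \<Rightarrow> (nat, 'k::field) mpoly set \<Rightarrow> (nat, 'k) mpoly set \<Rightarrow> bool" where
  "groebner_basis n r G J \<longleftrightarrow> finite G \<and> G \<subseteq> J \<and> lead_ideal n r G = lead_ideal n r J"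


subsection \<open>The FGLM algorithm\<close>

definition mat_monomial :: "nat \<Rightarrow> nat \<Rightarrow> (nat \<Rightarrow> 'k::field mat) \<Rightarrow> (nat \<Rightarrow>\<^sub>0 nat) \<Rightarrow> 'k mat" where
  "mat_monomial n D M t =
     foldr (\<lambda>i A. (M i ^\<^sub>m Poly_Mapping.lookup t i) * A) [1..<Suc n] (1\<^sub>m D)"

definition mat_lincomb :: "nat \<Rightarrow> ('i \<Rightarrow> 'k::field) \<Rightarrow> ('i \<Rightarrow> 'k mat) \<Rightarrow> 'i set \<Rightarrow> 'k mat" where
  "mat_lincomb D c A S = mat D D (\<lambda>(p, q). \<Sum>v\<in>S. c v * A v $$ (p, q))"

text \<open>
  \<open>M 1, \<dots>, M n\<close> are \<open>D \<times> D\<close> matrices, and the state is \<open>(L, S, G)\<close>. The coefficients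
  chosen by \<open>SOME\<close> are unique on \<open>S\<close>, since the matrices \<open>M\<^sup>v\<close> with \<open>v \<in> S\<close> stay linearly
  independent throughout the run. Termination is not built in: the result is
  \<^const>\<open>None\<close> if the loop does not terminate.
\<close>

definition fglm_step ::
  "nat \<Rightarrow> (nat \<Rightarrow>\<^sub>0 nat) rel \<Rightarrow> nat \<Rightarrow> (nat \<Rightarrow> 'k::field mat) \<Rightarrow>
   (nat \<Rightarrow>\<^sub>0 nat) set \<times> (nat \<Rightarrow>\<^sub>0 nat) set \<times> (nat, 'k) mpoly set \<Rightarrow>
   (nat \<Rightarrow>\<^sub>0 nat) set \<times> (nat \<Rightarrow>\<^sub>0 nat) set \<times> (nat, 'k) mpoly set" where
  "fglm_step n r D M = (\<lambda>(L, S, G).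
     let u = (THE u. u \<in> L \<and> (\<forall>v\<in>L. (u, v) \<in> r));
         relation = (\<lambda>c. mat_monomial n D M u = mat_lincomb D c (mat_monomial n D M) S)
     in if \<exists>g\<in>G. \<exists>w. u = lead_monomial r g + w then (L - {u}, S, G)
        else if \<exists>c. relation c then
          (let c = (SOME c. relation c)
           in (L - {u}, S, insert (monom_poly u - (\<Sum>v\<in>S. Poly_Mapping.single v (c v))) G))
        else (L - {u} \<union> (\<lambda>i. u + Poly_Mapping.single i 1) ` {1..n}, insert u S, G))"

definition fglm ::
  "nat \<Rightarrow> (nat \<Rightarrow>\<^sub>0 nat) rel \<Rightarrow> nat \<Rightarrow> (nat \<Rightarrow> 'k::field mat) \<Rightarrow> (nat, 'k) mpoly set option" where
  "fglm n r D M =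
     map_option (\<lambda>(L, S, G). G)
       (while_option (\<lambda>(L, S, G). L \<noteq> {}) (fglm_step n r D M) ({0}, {}, {}))"

end

theory Submission
  imports Defs "HOL-Library.Function_Algebras"
begin

text \<open>
  The proof identifies the dehomogenized ideal of \<open>J\<^sub>b\<close> with the ideal of all polynomials \<open>p\<close> such
  that \<open>p(M\<^sub>1, \<dots>, M\<^sub>n) = 0\<close>, where \<open>M\<^sub>i\<close> is the matrix of \<open>x\<^sub>i/x\<^sub>0\<close> on \<open>(R/I)\<^bsub>a,b\<^esub>\<close>; this is lemma
  \<open>relation_ideal_eq_affine_ideal\<close>. The FGLM algorithm computes a Groebner basis of the ideal of
  relations between any family of matrices that is multiplicative on monomials, which is lemma
  \<open>fglm_correct\<close>.

  The algebraic core is that multiplication by \<open>x\<^sub>0\<close> is bijective from \<open>(R/I)\<^bsub>s,b\<^esub>\<close> to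
  \<open>(R/I)\<^bsub>s+1,b\<^esub>\<close> for every \<open>s \<ge> a\<close>. It is onto because \<open>R/(I, x\<^sub>0)\<close> vanishes in bidegree \<open>(a, b)\<close> and
  therefore in bidegree \<open>(s, b)\<close> for all larger \<open>s\<close>. For \<open>s = a\<close> it is then injective, because the two
  dimensions agree. Injectivity persists in higher degrees (\<open>x0_injective\<close>) because \<open>I\<close> is
  generated in bidegrees at most \<open>(a, b)\<close>: by an elimination argument, a relation \<open>x\<^sub>0 f \<in> I\<close> is
  brought down to degree \<open>a\<close>.

  Since powers of \<open>x\<^sub>0\<close> may be cancelled, an equation between products of the \<open>M\<^sub>i\<close> can be checked
  after multiplication by a power of \<open>x\<^sub>0\<close>, where it becomes an equation between products of
  variables. So the matrices commute (\<open>A_add\<close>), and \<open>p(M\<^sub>1, \<dots>, M\<^sub>n) = 0\<close> means that the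
  homogenization of \<open>p\<close> annihilates \<open>(R/I)\<^bsub>a,b\<^esub>\<close> (\<open>relation_ideal_iff_homogenize\<close>). Up to powers of
  \<open>x\<^sub>0\<close>, which are units in the localization, this is membership in \<open>J\<^sub>b\<close>.

  In the run of FGLM the matrices of the monomials in \<open>S\<close> stay linearly independent, which bounds
  the number of these monomials and forces termination. At the end every monomial is either in \<open>S\<close>
  or divisible by a leading monomial of the output. Reduction by the output writes the matrix of
  any monomial as a combination of matrices of monomials in \<open>S\<close> that are not larger
  (\<open>span_of_standard\<close>). So no leading monomial of a relation lies in \<open>S\<close>, and all of them are
  divisible by leading monomials of the output.
\<close>

\<comment> \<open>The exponent 1 in \<open>var_poly\<close> would otherwise be rewritten to \<open>Suc 0\<close>.\<close>
declare One_nat_def [simp del]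

section \<open>Subrings of a commutative ring\<close>

lemma subring_cring:
  fixes C :: "'r::comm_ring_1 set"
  assumes "0 \<in> C" "1 \<in> C" "\<And>x y. x \<in> C \<Longrightarrow> y \<in> C \<Longrightarrow> x + y \<in> C"
    "\<And>x y. x \<in> C \<Longrightarrow> y \<in> C \<Longrightarrow> x * y \<in> C" "\<And>x. x \<in> C \<Longrightarrow> - x \<in> C"
  shows "cring \<lparr>carrier = C, mult = (*), one = 1, zero = 0, add = (+)\<rparr>" (is "cring ?R")
proof (rule cringI)
  show "abelian_group ?R"
  proof (rule abelian_groupI)
    fix x assume "x \<in> carrier ?R"
    then show "\<exists>y\<in>carrier ?R. y \<oplus>\<^bsub>?R\<^esub> x = \<zero>\<^bsub>?R\<^esub>"
      using assms(5) by (intro bexI[of _ "- x"]) auto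
  qed (use assms in \<open>auto simp: algebra_simps\<close>)
  show "Group.comm_monoid ?R"
    by (rule comm_monoidI) (use assms in \<open>auto simp: algebra_simps\<close>)
qed (use assms in \<open>auto simp: algebra_simps\<close>)

lemma subring_idealI:
  fixes C :: "'r::comm_ring_1 set"
  defines "R \<equiv> \<lparr>carrier = C, mult = (*), one = 1, zero = 0, add = (+)\<rparr>"
  assumes C: "cring R" "- 1 \<in> C"
    and J: "J \<subseteq> C" "0 \<in> J" "\<And>f g. f \<in> J \<Longrightarrow> g \<in> J \<Longrightarrow> f + g \<in> J"
    "\<And>f x. f \<in> J \<Longrightarrow> x \<in> C \<Longrightarrow> x * f \<in> J"
  shows "ideal J R"
proof (rule idealI)
  interpret cring R by fact
  show "ring R" by (rule ring_axioms)
  have [simp]: "carrier R = C" "add R = (+)" "mult R = (*)" "zero R = 0"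
    by (simp_all add: R_def)
  have neg: "- f \<in> J" if "f \<in> J" for f
    using J(4)[OF that C(2)] by simp
  have inv: "\<ominus>\<^bsub>R\<^esub> f = - f" if "f \<in> J" for f
    using that neg[OF that] J(1) minus_equality[of "- f" f] by auto
  show "subgroup J (add_monoid R)"
    using J neg inv by (intro add.subgroupI) (auto simp flip: a_inv_def)
  show "x \<otimes>\<^bsub>R\<^esub> f \<in> J" "f \<otimes>\<^bsub>R\<^esub> x \<in> J" if "f \<in> J" "x \<in> carrier R" for f x
    using J(4)[OF that(1), of x] that(2) by (simp_all add: mult.commute)
qed

section \<open>Polynomials as finite sums of terms\<close>

lemma poly_sum_of_terms:
  fixes f :: "('v, 'k::comm_ring_1) mpoly"
  shows "f = (\<Sum>t\<in>Poly_Mapping.keys f. Poly_Mapping.single t (Poly_Mapping.lookup f t))"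
  by (rule poly_mapping_eqI)
    (auto simp: lookup_sum lookup_single when_def sum.delta in_keys_iff)

lemma poly_additive_induct:
  fixes f :: "('v, 'k::comm_ring_1) mpoly"
  assumes "P 0" and "\<And>g h. P g \<Longrightarrow> P h \<Longrightarrow> P (g + h)"
    and "\<And>t. t \<in> Poly_Mapping.keys f \<Longrightarrow> P (Poly_Mapping.single t (Poly_Mapping.lookup f t))"
  shows "P f"
proof -
  have "P (\<Sum>t\<in>T. Poly_Mapping.single t (Poly_Mapping.lookup f t))"
    if "finite T" "T \<subseteq> Poly_Mapping.keys f" for T
    using that by (induction T rule: finite_induct) (auto intro: assms)
  from this[of "Poly_Mapping.keys f"] show ?thesis
    using poly_sum_of_terms[of f] by simp
qed

lemma keys_add_exponents:
  fixes s t :: "'v \<Rightarrow>\<^sub>0 nat"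
  shows "Poly_Mapping.keys (s + t) = Poly_Mapping.keys s \<union> Poly_Mapping.keys t"
  by (auto simp: in_keys_iff lookup_add)

lemma keys_diff_exponents:
  fixes s t :: "'v \<Rightarrow>\<^sub>0 nat"
  shows "Poly_Mapping.keys (s - t) \<subseteq> Poly_Mapping.keys s"
  by (auto simp: in_keys_iff lookup_minus)

lemma exponent_split:
  fixes t :: "'v \<Rightarrow>\<^sub>0 nat"
  assumes "v \<in> Poly_Mapping.keys t"
  shows "t = Poly_Mapping.single v 1 + (t - Poly_Mapping.single v 1)"
  using assms
  by (intro poly_mapping_eqI) (auto simp: lookup_add lookup_minus lookup_single when_def in_keys_iff)

lemma keys_times_single:
  fixes f :: "('v, 'k::comm_ring_1) mpoly"
  shows "Poly_Mapping.keys (Poly_Mapping.single s c * f) \<subseteq> (\<lambda>t. s + t) ` Poly_Mapping.keys f"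
  using keys_mult[of "Poly_Mapping.single s c" f] by (force split: if_splits)

lemma lookup_times_monom:
  fixes f :: "('v, 'k::comm_ring_1) mpoly"
  shows "Poly_Mapping.lookup (Poly_Mapping.single s c * f) (s + t) = c * Poly_Mapping.lookup f t"
proof (rule poly_additive_induct[where f = f])
  fix u
  show "Poly_Mapping.lookup (Poly_Mapping.single s c *
      Poly_Mapping.single u (Poly_Mapping.lookup f u)) (s + t) =
      c * Poly_Mapping.lookup (Poly_Mapping.single u (Poly_Mapping.lookup f u)) t"
    by (auto simp: mult_single lookup_single when_def)
qed (auto simp: algebra_simps lookup_add)

section \<open>Polynomial rings and their ideals\<close>

lemma poly_ring_simps [simp]:
  "mult (poly_ring V) = (*)" "one (poly_ring V) = 1" "zero (poly_ring V) = 0"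
  "add (poly_ring V) = (+)"
  by (simp_all add: poly_ring_def)

lemma poly_ring_carrier:
  "f \<in> carrier (poly_ring V) \<longleftrightarrow> (\<forall>t\<in>Poly_Mapping.keys f. Poly_Mapping.keys t \<subseteq> V)"
  by (simp add: poly_ring_def)

lemma poly_ring_zero [simp]: "0 \<in> carrier (poly_ring V)"
  by (simp add: poly_ring_carrier)

lemma poly_ring_single [simp]:
  "Poly_Mapping.keys t \<subseteq> V \<Longrightarrow> Poly_Mapping.single t c \<in> carrier (poly_ring V)"
  by (simp add: poly_ring_carrier)

lemma poly_ring_one [simp]: "1 \<in> carrier (poly_ring V)"
  by (simp add: poly_ring_carrier)

lemma poly_ring_add [simp]:
  "f \<in> carrier (poly_ring V) \<Longrightarrow> g \<in> carrier (poly_ring V) \<Longrightarrow> f + g \<in> carrier (poly_ring V)"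
  using keys_add[of f g] by (auto simp: poly_ring_carrier)

lemma keys_uminus_poly [simp]:
  "Poly_Mapping.keys (- f :: ('v, 'k::comm_ring_1) mpoly) = Poly_Mapping.keys f"
  by (auto simp: in_keys_iff)

lemma poly_ring_uminus [simp]:
  "- f \<in> carrier (poly_ring V) \<longleftrightarrow> f \<in> carrier (poly_ring V)"
  by (simp add: poly_ring_carrier)

lemma poly_ring_diff [simp]:
  "f \<in> carrier (poly_ring V) \<Longrightarrow> g \<in> carrier (poly_ring V) \<Longrightarrow> f - g \<in> carrier (poly_ring V)"
  using poly_ring_add[of f V "- g"] by simp

lemma poly_ring_mult [simp]:
  assumes "f \<in> carrier (poly_ring V)" "g \<in> carrier (poly_ring V)"
  shows "f * g \<in> carrier (poly_ring V)"
  using assms keys_mult[of f g] by (fastforce simp: poly_ring_carrier keys_add_exponents)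

lemma poly_ring_power [simp]:
  "f \<in> carrier (poly_ring V) \<Longrightarrow> f ^ d \<in> carrier (poly_ring V)"
  by (induction d) auto

lemma poly_ring_sum [simp]:
  "(\<And>i. i \<in> A \<Longrightarrow> f i \<in> carrier (poly_ring V)) \<Longrightarrow> sum f A \<in> carrier (poly_ring V)"
  by (induction A rule: infinite_finite_induct) auto

lemma poly_ring_prod [simp]:
  "(\<And>i. i \<in> A \<Longrightarrow> f i \<in> carrier (poly_ring V)) \<Longrightarrow> prod f A \<in> carrier (poly_ring V)"
  by (induction A rule: infinite_finite_induct) auto

lemma poly_ring_cring: "cring (poly_ring V :: ('v, 'k::comm_ring_1) mpoly ring)"
  unfolding poly_ring_def
  by (rule subring_cring) (simp_all flip: poly_ring_carrier)

interpretation poly_ring: cring "poly_ring V :: ('v, 'k::comm_ring_1) mpoly ring" for V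
  by (rule poly_ring_cring)

lemma poly_ring_idealI:
  fixes J :: "('v, 'k::comm_ring_1) mpoly set"
  assumes "J \<subseteq> carrier (poly_ring V)" "0 \<in> J" "\<And>f g. f \<in> J \<Longrightarrow> g \<in> J \<Longrightarrow> f + g \<in> J"
    and "\<And>f r. f \<in> J \<Longrightarrow> r \<in> carrier (poly_ring V) \<Longrightarrow> r * f \<in> J"
  shows "ideal J (poly_ring V)"
  using assms poly_ring.cring_axioms[of V] unfolding poly_ring_def
  by (intro subring_idealI) simp_all

locale poly_ideal =
  fixes V :: "'v set" and I :: "('v, 'k::comm_ring_1) mpoly set"
  assumes ideal_I: "ideal I (poly_ring V)"
begin

sublocale I: ideal I "poly_ring V" by (rule ideal_I)

lemma in_carrier: "f \<in> I \<Longrightarrow> f \<in> carrier (poly_ring V)"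
  using I.a_subset by auto

lemma zero [simp]: "0 \<in> I"
  using I.zero_closed by simp

lemma add [simp]: "f \<in> I \<Longrightarrow> g \<in> I \<Longrightarrow> f + g \<in> I"
  using I.a_closed[of f g] by simp

lemma mult [simp]: "f \<in> I \<Longrightarrow> r \<in> carrier (poly_ring V) \<Longrightarrow> r * f \<in> I"
  using I.I_l_closed[of f r] by simp

lemma mult_right [simp]: "f \<in> I \<Longrightarrow> r \<in> carrier (poly_ring V) \<Longrightarrow> f * r \<in> I"
  using mult[of f r] by (simp add: mult.commute)

lemma uminus [simp]: "f \<in> I \<Longrightarrow> - f \<in> I"
  using mult[of f "- 1"] by simp

lemma diff [simp]: "f \<in> I \<Longrightarrow> g \<in> I \<Longrightarrow> f - g \<in> I"
  using add[of f "- g"] by simp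

lemma sum [simp]: "(\<And>i. i \<in> A \<Longrightarrow> f i \<in> I) \<Longrightarrow> sum f A \<in> I"
  by (induction A rule: infinite_finite_induct) auto

lemma coset_eq_iff:
  assumes "f \<in> carrier (poly_ring V)" "g \<in> carrier (poly_ring V)"
  shows "I +>\<^bsub>poly_ring V\<^esub> f = I +>\<^bsub>poly_ring V\<^esub> g \<longleftrightarrow> f - g \<in> I"
  using poly_ring.quotient_eq_iff_same_a_r_cos[OF ideal_I assms]
    poly_ring.minus_equality[of V "- g" g] assms
  by (simp add: a_minus_def)

end

text \<open>
  The polynomials all of whose multiples satisfy an additive property \<open>P\<close> form an ideal, so
  it is enough to check \<open>P\<close> on the term multiples of the generators.
\<close>

lemma genideal_poly_induct [consumes 2, case_names zero add gen]:
  fixes F :: "('v, 'k::comm_ring_1) mpoly set"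
  assumes "f \<in> genideal (poly_ring V) F" and F: "F \<subseteq> carrier (poly_ring V)"
    and P0: "P 0" and Padd: "\<And>g h. P g \<Longrightarrow> P h \<Longrightarrow> P (g + h)"
    and Pgen: "\<And>t c g. Poly_Mapping.keys t \<subseteq> V \<Longrightarrow> g \<in> F \<Longrightarrow> P (Poly_Mapping.single t c * g)"
  shows "P f"
proof -
  define Q where "Q = {g \<in> carrier (poly_ring V). \<forall>r\<in>carrier (poly_ring V). P (r * g)}"
  have "ideal Q (poly_ring V)"
  proof (rule poly_ring_idealI)
    show "g + h \<in> Q" if "g \<in> Q" "h \<in> Q" for g h
      using that by (auto simp: Q_def algebra_simps intro: Padd)
    show "r * g \<in> Q" if "g \<in> Q" "r \<in> carrier (poly_ring V)" for g r
      using that by (auto simp: Q_def simp flip: mult.assoc)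
  qed (auto simp: Q_def P0)
  moreover have "F \<subseteq> Q"
  proof
    fix g assume g: "g \<in> F"
    have "P (r * g)" if "r \<in> carrier (poly_ring V)" for r
      by (rule poly_additive_induct[where f = r])
        (use that g in \<open>auto simp: poly_ring_carrier distrib_right intro: P0 Padd Pgen\<close>)
    with g F show "g \<in> Q" by (auto simp: Q_def)
  qed
  ultimately have "f \<in> Q"
    using assms(1) poly_ring.genideal_minimal[of Q V F] by blast
  then have "\<And>r. r \<in> carrier (poly_ring V) \<Longrightarrow> P (r * f)" by (simp add: Q_def)
  from this[of 1] show ?thesis by simp
qed

section \<open>Bidegrees\<close>

lemma xdeg_superset:
  assumes "finite A" "Poly_Mapping.keys t \<subseteq> A"
  shows "xdeg t = (\<Sum>v\<in>A. case v of X _ \<Rightarrow> Poly_Mapping.lookup t v | Y _ \<Rightarrow> 0)"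
  unfolding xdeg_def using assms
  by (intro sum.mono_neutral_left) (auto simp: in_keys_iff split: var.splits)

lemma ydeg_superset:
  assumes "finite A" "Poly_Mapping.keys t \<subseteq> A"
  shows "ydeg t = (\<Sum>v\<in>A. case v of X _ \<Rightarrow> 0 | Y _ \<Rightarrow> Poly_Mapping.lookup t v)"
  unfolding ydeg_def using assms
  by (intro sum.mono_neutral_left) (auto simp: in_keys_iff split: var.splits)

lemma xdeg_add [simp]: "xdeg (s + t) = xdeg s + xdeg t"
proof -
  let ?A = "Poly_Mapping.keys s \<union> Poly_Mapping.keys t"
  have st: "Poly_Mapping.keys (s + t) \<subseteq> ?A" by (simp add: keys_add_exponents)
  show ?thesis
    unfolding xdeg_superset[OF _ st, simplified] xdeg_superset[of ?A s, simplified]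
      xdeg_superset[of ?A t, simplified] sum.distrib[symmetric]
    by (intro sum.cong) (auto simp: lookup_add split: var.splits)
qed

lemma ydeg_add [simp]: "ydeg (s + t) = ydeg s + ydeg t"
proof -
  let ?A = "Poly_Mapping.keys s \<union> Poly_Mapping.keys t"
  have st: "Poly_Mapping.keys (s + t) \<subseteq> ?A" by (simp add: keys_add_exponents)
  show ?thesis
    unfolding ydeg_superset[OF _ st, simplified] ydeg_superset[of ?A s, simplified]
      ydeg_superset[of ?A t, simplified] sum.distrib[symmetric]
    by (intro sum.cong) (auto simp: lookup_add split: var.splits)
qed

lemma deg_zero [simp]: "xdeg 0 = 0" "ydeg 0 = 0"
  by (simp_all add: xdeg_def ydeg_def)

lemma deg_single [simp]:
  "xdeg (Poly_Mapping.single (X i) d) = d" "ydeg (Poly_Mapping.single (X i) d) = 0"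
  "xdeg (Poly_Mapping.single (Y i) d) = 0" "ydeg (Poly_Mapping.single (Y i) d) = d"
  by (simp_all add: xdeg_def ydeg_def)

lemma xdeg_pos_split:
  assumes "xdeg t > 0"
  obtains i t' where "X i \<in> Poly_Mapping.keys t" "t = Poly_Mapping.single (X i) 1 + t'"
proof -
  have "\<exists>v\<in>Poly_Mapping.keys t. (case v of X _ \<Rightarrow> Poly_Mapping.lookup t v | Y _ \<Rightarrow> 0) \<noteq> 0"
    using assms unfolding xdeg_def by (metis (no_types, lifting) less_not_refl sum.neutral)
  then obtain i where "X i \<in> Poly_Mapping.keys t" by (metis var.exhaust var.simps(6))
  with exponent_split[OF this] that show ?thesis by blast
qed

lemma ydeg_pos_split:
  assumes "ydeg t > 0"
  obtains j t' where "Y j \<in> Poly_Mapping.keys t" "t = Poly_Mapping.single (Y j) 1 + t'"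
proof -
  have "\<exists>v\<in>Poly_Mapping.keys t. (case v of X _ \<Rightarrow> 0 | Y _ \<Rightarrow> Poly_Mapping.lookup t v) \<noteq> 0"
    using assms unfolding ydeg_def by (metis (no_types, lifting) less_not_refl sum.neutral)
  then obtain j where "Y j \<in> Poly_Mapping.keys t" by (metis var.exhaust var.simps(5))
  with exponent_split[OF this] that show ?thesis by blast
qed

definition bidegree_part :: "nat \<Rightarrow> nat \<Rightarrow> (var, 'k::comm_ring_1) mpoly \<Rightarrow> (var, 'k) mpoly" where
  "bidegree_part a b f = (\<Sum>t\<in>Poly_Mapping.keys f.
     if xdeg t = a \<and> ydeg t = b then Poly_Mapping.single t (Poly_Mapping.lookup f t) else 0)"

lemma lookup_bidegree_part:
  "Poly_Mapping.lookup (bidegree_part a b f) t =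
     (if xdeg t = a \<and> ydeg t = b then Poly_Mapping.lookup f t else 0)"
proof -
  have "Poly_Mapping.lookup (bidegree_part a b f) t = (\<Sum>s\<in>Poly_Mapping.keys f.
      if s = t then (if xdeg t = a \<and> ydeg t = b then Poly_Mapping.lookup f t else 0) else 0)"
    unfolding bidegree_part_def lookup_sum
    by (rule sum.cong) (simp_all add: lookup_single when_def)
  also have "\<dots> = (if xdeg t = a \<and> ydeg t = b then Poly_Mapping.lookup f t else 0)"
    unfolding sum.delta[OF finite_keys] by (simp add: in_keys_iff)
  finally show ?thesis .
qed

lemma bidegree_part_add: "bidegree_part a b (f + g) = bidegree_part a b f + bidegree_part a b g"
  by (rule poly_mapping_eqI) (simp add: lookup_bidegree_part lookup_add)

lemma bidegree_part_zero [simp]: "bidegree_part a b 0 = 0"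
  by (simp add: bidegree_part_def)

lemma keys_bidegree_part:
  "Poly_Mapping.keys (bidegree_part a b f) = {t \<in> Poly_Mapping.keys f. xdeg t = a \<and> ydeg t = b}"
  by (auto simp: in_keys_iff lookup_bidegree_part split: if_splits)

lemma bi_ring_simps [simp]:
  "mult (bi_ring n m) = (*)" "one (bi_ring n m) = 1" "zero (bi_ring n m) = 0"
  "add (bi_ring n m) = (+)"
  by (simp_all add: bi_ring_def)

lemma bihom_part_carrier: "f \<in> bihom_part n m a b \<Longrightarrow> f \<in> carrier (bi_ring n m)"
  by (simp add: bihom_part_def)

lemma bihom_part_iff:
  "f \<in> bihom_part n m a b \<longleftrightarrow> (\<forall>t\<in>Poly_Mapping.keys f.
     Poly_Mapping.keys t \<subseteq> X ` {..n} \<union> Y ` {..m} \<and> xdeg t = a \<and> ydeg t = b)"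
  by (auto simp: bihom_part_def bi_ring_def poly_ring_carrier)

lemma bihom_part_zero [simp]: "0 \<in> bihom_part n m a b"
  by (simp add: bihom_part_iff)

lemma bihom_part_add [simp]:
  "f \<in> bihom_part n m a b \<Longrightarrow> g \<in> bihom_part n m a b \<Longrightarrow> f + g \<in> bihom_part n m a b"
  using keys_add[of f g] by (auto simp: bihom_part_iff)

lemma bihom_part_uminus [simp]: "- f \<in> bihom_part n m a b \<longleftrightarrow> f \<in> bihom_part n m a b"
  by (auto simp: bihom_part_iff)

lemma bihom_part_diff [simp]:
  "f \<in> bihom_part n m a b \<Longrightarrow> g \<in> bihom_part n m a b \<Longrightarrow> f - g \<in> bihom_part n m a b"
  using bihom_part_add[of f n m a b "- g"] by simp

lemma bihom_part_sum [simp]: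
  "(\<And>i. i \<in> A \<Longrightarrow> f i \<in> bihom_part n m a b) \<Longrightarrow> sum f A \<in> bihom_part n m a b"
  by (induction A rule: infinite_finite_induct) auto

lemma bihom_part_mult:
  assumes "f \<in> bihom_part n m a b" "g \<in> bihom_part n m c d"
  shows "f * g \<in> bihom_part n m (a + c) (b + d)"
proof -
  have "Poly_Mapping.keys t \<subseteq> X ` {..n} \<union> Y ` {..m} \<and> xdeg t = a + c \<and> ydeg t = b + d"
    if t: "t \<in> Poly_Mapping.keys (f * g)" for t
  proof -
    obtain u v where "t = u + v" "u \<in> Poly_Mapping.keys f" "v \<in> Poly_Mapping.keys g"
      using t keys_mult[of f g] by blast
    with assms show ?thesis by (simp add: bihom_part_iff keys_add_exponents)
  qed
  then show ?thesis by (simp add: bihom_part_iff)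
qed

lemma bihom_part_const [simp]: "const_poly c \<in> bihom_part n m 0 0"
  by (simp add: bihom_part_iff)

lemma bihom_part_smult [simp]:
  "f \<in> bihom_part n m a b \<Longrightarrow> const_poly c * f \<in> bihom_part n m a b"
  using bihom_part_mult[OF bihom_part_const, of f n m a b c] by simp

lemma bihom_part_single [simp]:
  "Poly_Mapping.keys t \<subseteq> X ` {..n} \<union> Y ` {..m} \<Longrightarrow> xdeg t = a \<Longrightarrow> ydeg t = b \<Longrightarrow>
     Poly_Mapping.single t c \<in> bihom_part n m a b"
  by (simp add: bihom_part_iff)

lemma bihom_part_X [simp]: "i \<le> n \<Longrightarrow> var_poly (X i) \<in> bihom_part n m 1 0"
  by (intro bihom_part_single) auto

lemma bihom_part_X_mult [simp]:
  "i \<le> n \<Longrightarrow> f \<in> bihom_part n m a b \<Longrightarrow> var_poly (X i) * f \<in> bihom_part n m (Suc a) b"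
  using bihom_part_mult[OF bihom_part_X, of i n f m a b] by (simp add: plus_1_eq_Suc)

lemma bihom_part_X_power_mult [simp]:
  "i \<le> n \<Longrightarrow> f \<in> bihom_part n m a b \<Longrightarrow> var_poly (X i) ^ d * f \<in> bihom_part n m (d + a) b"
  by (induction d) (simp_all add: mult.assoc)

lemma bidegree_part_of_bihom:
  assumes "f \<in> bihom_part n m c d"
  shows "bidegree_part a b f = (if c = a \<and> d = b then f else 0)"
  using assms
  by (intro poly_mapping_eqI) (auto simp: lookup_bidegree_part bihom_part_iff in_keys_iff)

lemma var_poly_carrier [simp]:
  "i \<le> n \<Longrightarrow> var_poly (X i) \<in> carrier (bi_ring n m)"
  "j \<le> m \<Longrightarrow> var_poly (Y j) \<in> carrier (bi_ring n m)"
  by (auto simp: bi_ring_def)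

lemma single_X_add: "Poly_Mapping.single (Poly_Mapping.single v 1 + t) c =
    var_poly v * Poly_Mapping.single t (c::'k::comm_ring_1)"
  by (simp add: mult_single)

section \<open>Graded pieces of the quotient as vector spaces\<close>

locale bi_ideal =
  fixes n m :: nat and I :: "(var, 'k::field) mpoly set"
  assumes ideal_bi: "ideal I (bi_ring n m)"
begin

sublocale poly_ideal "X ` {..n} \<union> Y ` {..m}" I
  using ideal_bi by (simp add: bi_ring_def poly_ideal_def)

lemma bi_ring_carrier_simps [simp]:
  "f \<in> carrier (bi_ring n m) \<Longrightarrow> g \<in> carrier (bi_ring n m) \<Longrightarrow> f + g \<in> carrier (bi_ring n m)"
  "f \<in> carrier (bi_ring n m) \<Longrightarrow> g \<in> carrier (bi_ring n m) \<Longrightarrow> f - g \<in> carrier (bi_ring n m)"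
  "f \<in> carrier (bi_ring n m) \<Longrightarrow> g \<in> carrier (bi_ring n m) \<Longrightarrow> f * g \<in> carrier (bi_ring n m)"
  "0 \<in> carrier (bi_ring n m)" "1 \<in> carrier (bi_ring n m)"
  "const_poly c \<in> carrier (bi_ring n m)"
  by (simp_all add: bi_ring_def)

lemma ideal_mult: "f \<in> I \<Longrightarrow> r \<in> carrier (bi_ring n m) \<Longrightarrow> r * f \<in> I"
  by (simp add: bi_ring_def)

lemma ideal_in_carrier: "f \<in> I \<Longrightarrow> f \<in> carrier (bi_ring n m)"
  using in_carrier by (simp add: bi_ring_def)

abbreviation cls :: "(var, 'k) mpoly \<Rightarrow> (var, 'k) mpoly set" where
  "cls f \<equiv> I +>\<^bsub>bi_ring n m\<^esub> f"

abbreviation piece :: "nat \<Rightarrow> nat \<Rightarrow> ('k, (var, 'k) mpoly set) module" where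
  "piece a b \<equiv> quot_part n m I a b"

lemma cls_eq_iff:
  "f \<in> carrier (bi_ring n m) \<Longrightarrow> g \<in> carrier (bi_ring n m) \<Longrightarrow> cls f = cls g \<longleftrightarrow> f - g \<in> I"
  using coset_eq_iff by (simp add: bi_ring_def)

lemma cls_eq_iff_bihom:
  "f \<in> bihom_part n m a b \<Longrightarrow> g \<in> bihom_part n m a b \<Longrightarrow> cls f = cls g \<longleftrightarrow> f - g \<in> I"
  by (rule cls_eq_iff) (auto dest: bihom_part_carrier)

lemma cls_hom: "cls \<in> Ring.ring_hom (bi_ring n m) (bi_ring n m Quot I)"
  unfolding bi_ring_def by (rule I.rcos_ring_hom)

lemma cls_add: "f \<in> carrier (bi_ring n m) \<Longrightarrow> g \<in> carrier (bi_ring n m) \<Longrightarrow>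
    cls f \<oplus>\<^bsub>bi_ring n m Quot I\<^esub> cls g = cls (f + g)"
  using Ring.ring_hom_add[OF cls_hom, of f g] by simp

lemma cls_mult: "f \<in> carrier (bi_ring n m) \<Longrightarrow> g \<in> carrier (bi_ring n m) \<Longrightarrow>
    cls f \<otimes>\<^bsub>bi_ring n m Quot I\<^esub> cls g = cls (f * g)"
  using Ring.ring_hom_mult[OF cls_hom, of f g] by simp

lemma piece_carrier: "carrier (piece a b) = cls ` bihom_part n m a b"
  by (simp add: quot_part_def Let_def)

lemma cls_in_piece [simp]: "f \<in> bihom_part n m a b \<Longrightarrow> cls f \<in> carrier (piece a b)"
  by (simp add: piece_carrier)

lemma piece_add: "f \<in> carrier (bi_ring n m) \<Longrightarrow> g \<in> carrier (bi_ring n m) \<Longrightarrow>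
    cls f \<oplus>\<^bsub>piece a b\<^esub> cls g = cls (f + g)"
  by (simp add: quot_part_def Let_def cls_add)

lemma piece_zero: "\<zero>\<^bsub>piece a b\<^esub> = cls 0"
proof -
  have "cls 0 = I"
    unfolding bi_ring_def using I.a_rcos_const[of 0] by simp
  then show ?thesis by (simp add: quot_part_def Let_def FactRing_def)
qed

lemma piece_smult:
  "f \<in> carrier (bi_ring n m) \<Longrightarrow> c \<odot>\<^bsub>piece a b\<^esub> cls f = cls (const_poly c * f)"
  by (simp add: quot_part_def Let_def cls_mult)

lemma piece_vectorspace: "vectorspace class_ring (piece a b)"
proof -
  note [simp] = piece_add piece_zero piece_smult bihom_part_carrier
  have smult_props: "c \<odot>\<^bsub>piece a b\<^esub> x \<in> carrier (piece a b)"
    "(c + d) \<odot>\<^bsub>piece a b\<^esub> x = c \<odot>\<^bsub>piece a b\<^esub> x \<oplus>\<^bsub>piece a b\<^esub> d \<odot>\<^bsub>piece a b\<^esub> x"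
    "(c * d) \<odot>\<^bsub>piece a b\<^esub> x = c \<odot>\<^bsub>piece a b\<^esub> (d \<odot>\<^bsub>piece a b\<^esub> x)"
    "1 \<odot>\<^bsub>piece a b\<^esub> x = x"
    if "x \<in> carrier (piece a b)" for c d x
    using that by (auto simp: piece_carrier single_add distrib_right mult.assoc[symmetric] mult_single)
  have add_props: "x \<oplus>\<^bsub>piece a b\<^esub> y \<in> carrier (piece a b)"
    "x \<oplus>\<^bsub>piece a b\<^esub> y = y \<oplus>\<^bsub>piece a b\<^esub> x"
    "c \<odot>\<^bsub>piece a b\<^esub> (x \<oplus>\<^bsub>piece a b\<^esub> y) = c \<odot>\<^bsub>piece a b\<^esub> x \<oplus>\<^bsub>piece a b\<^esub> c \<odot>\<^bsub>piece a b\<^esub> y"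
    if "x \<in> carrier (piece a b)" "y \<in> carrier (piece a b)" for c x y
    using that by (auto simp: piece_carrier algebra_simps)
  have "abelian_group (piece a b)"
  proof (rule abelian_groupI)
    fix x assume "x \<in> carrier (piece a b)"
    then obtain f where "x = cls f" "f \<in> bihom_part n m a b" by (auto simp: piece_carrier)
    then show "\<exists>y\<in>carrier (piece a b). y \<oplus>\<^bsub>piece a b\<^esub> x = \<zero>\<^bsub>piece a b\<^esub>"
      by (intro bexI[of _ "cls (- f)"]) auto
  next
    fix x y z assume "x \<in> carrier (piece a b)" "y \<in> carrier (piece a b)" "z \<in> carrier (piece a b)"
    then show "x \<oplus>\<^bsub>piece a b\<^esub> y \<oplus>\<^bsub>piece a b\<^esub> z = x \<oplus>\<^bsub>piece a b\<^esub> (y \<oplus>\<^bsub>piece a b\<^esub> z)"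
      by (auto simp: piece_carrier algebra_simps)
  next
    fix x assume "x \<in> carrier (piece a b)"
    then show "\<zero>\<^bsub>piece a b\<^esub> \<oplus>\<^bsub>piece a b\<^esub> x = x" by (auto simp: piece_carrier)
  qed (use add_props in auto)
  moreover have "module class_ring (piece a b)"
    by (rule moduleI[OF class_cring.cring_axioms calculation])
      (use smult_props add_props in \<open>simp_all add: class_ring_simps\<close>)
  ultimately show ?thesis
    unfolding vectorspace_def using class_field.field_axioms by blast
qed

lemma piece_finsum:
  assumes "finite A" "\<And>i. i \<in> A \<Longrightarrow> f i \<in> bihom_part n m a b"
  shows "(\<Oplus>\<^bsub>piece a b\<^esub>i\<in>A. c i \<odot>\<^bsub>piece a b\<^esub> cls (f i)) = cls (\<Sum>i\<in>A. const_poly (c i) * f i)"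
proof -
  interpret V: vectorspace class_ring "piece a b" by (rule piece_vectorspace)
  show ?thesis
    using assms
  proof (induction A rule: finite_induct)
    case (insert x A)
    have "(\<lambda>i. c i \<odot>\<^bsub>piece a b\<^esub> cls (f i)) \<in> insert x A \<rightarrow> carrier (piece a b)"
      using insert.prems by (auto simp: class_ring_simps intro!: V.smult_closed)
    moreover have "(\<Sum>i\<in>A. const_poly (c i) * f i) \<in> bihom_part n m a b"
      using insert.prems by simp
    moreover have "f x \<in> bihom_part n m a b" using insert.prems by simp
    ultimately show ?case
      using insert bihom_part_carrier[of "f x" n m a b]
        bihom_part_carrier[of "\<Sum>i\<in>A. const_poly (c i) * f i" n m a b]
      by (simp add: piece_smult piece_add)
  qed (simp add: piece_zero)
qed

end

text \<open>
  This covers both linear maps of the proof: multiplication by \<open>x\<^sub>0\<close>, and the projection from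
  \<open>R/I\<close> to \<open>R/(I, x\<^sub>0)\<close>, for which \<open>g\<close> is the identity.
\<close>

lemma piece_linear_mapI:
  fixes I I' :: "(var, 'k::field) mpoly set"
  assumes "bi_ideal n m I" "bi_ideal n m I'"
    and T: "\<And>f. f \<in> bihom_part n m a b \<Longrightarrow> T (I +>\<^bsub>bi_ring n m\<^esub> f) = I' +>\<^bsub>bi_ring n m\<^esub> g f"
    and g: "\<And>f. f \<in> bihom_part n m a b \<Longrightarrow> g f \<in> bihom_part n m a' b'"
    and g_add: "\<And>f f'. g (f + f') = g f + g f'"
    and g_smult: "\<And>c f. g (const_poly c * f) = const_poly c * g f"
  shows "linear_map class_ring (quot_part n m I a b) (quot_part n m I' a' b') T"
proof -
  interpret I: bi_ideal n m I by fact
  interpret I': bi_ideal n m I' by fact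
  interpret V: vectorspace class_ring "I.piece a b" by (rule I.piece_vectorspace)
  interpret V': vectorspace class_ring "I'.piece a' b'" by (rule I'.piece_vectorspace)
  show ?thesis
  proof unfold_locales
    have "T x \<in> carrier (I'.piece a' b')" "T (c \<odot>\<^bsub>I.piece a b\<^esub> x) = c \<odot>\<^bsub>I'.piece a' b'\<^esub> T x"
      if x: "x \<in> carrier (I.piece a b)" for c x
    proof -
      obtain f where f: "x = I.cls f" "f \<in> bihom_part n m a b" using x by (auto simp: I.piece_carrier)
      then show "T x \<in> carrier (I'.piece a' b')"
        "T (c \<odot>\<^bsub>I.piece a b\<^esub> x) = c \<odot>\<^bsub>I'.piece a' b'\<^esub> T x"
        using g[OF f(2)] by (simp_all add: T I.piece_smult I'.piece_smult g_smult bihom_part_carrier)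
    qed
    moreover have "T (x \<oplus>\<^bsub>I.piece a b\<^esub> y) = T x \<oplus>\<^bsub>I'.piece a' b'\<^esub> T y"
      if x: "x \<in> carrier (I.piece a b)" and y: "y \<in> carrier (I.piece a b)" for x y
    proof -
      obtain f where f: "x = I.cls f" "f \<in> bihom_part n m a b" using x by (auto simp: I.piece_carrier)
      obtain h where h: "y = I.cls h" "h \<in> bihom_part n m a b" using y by (auto simp: I.piece_carrier)
      show ?thesis
        using f h g[OF f(2)] g[OF h(2)]
        by (simp add: T I.piece_add I'.piece_add g_add bihom_part_carrier)
    qed
    ultimately show "T \<in> LinearCombinations.module_hom class_ring (I.piece a b) (I'.piece a' b')"
      by (simp add: LinearCombinations.module_hom_def class_ring_simps)
  qed
qed

text \<open>
  By rank-nullity the kernel has dimension 0. Since the dimension is the least size of a finite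
  generating set, this makes the kernel trivial only once a finite generating set is known to exist.
\<close>

lemma linear_map_surj_imp_inj:
  assumes "linear_map K V W T" "vectorspace.fin_dim K V" "T ` carrier V = carrier W"
    and "vectorspace.dim K V = vectorspace.dim K W"
    and "v \<in> carrier V" "T v = \<zero>\<^bsub>W\<^esub>"
  shows "v = \<zero>\<^bsub>V\<^esub>"
proof -
  interpret linear_map K V W T by fact
  have im: "imT = carrier W" using assms(3) by (simp add: im_def)
  have "vectorspace.dim K (W.vs imT) + vectorspace.dim K (V.vs kerT) = V.dim"
    by (rule rank_nullity[OF assms(2)])
  moreover have "W.vs imT = W" by (simp add: im)
  ultimately have dim0: "vectorspace.dim K (V.vs kerT) = 0" using assms(4) by simp
  interpret ker: vectorspace K "V.vs kerT"
    by (rule V.subspace_is_vs[OF kerT_is_subspace])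
  have sub: "submodule K kerT V" by (rule ker_is_submodule)
  have "finite A \<and> card A \<le> V.dim" if "A \<subseteq> kerT \<and> ker.lin_indpt A" for A
  proof -
    have "V.module.lin_indpt A" using that V.module.span_li_not_depend(2)[OF _ sub] by blast
    moreover have "A \<subseteq> carrier V" using that by (auto simp: ker_def)
    ultimately show ?thesis using V.li_le_dim[OF assms(2)] by blast
  qed
  then have "\<exists>A. finite A \<and> maximal A (\<lambda>S. S \<subseteq> kerT \<and> ker.lin_indpt S)"
    by (rule maximal_exists[where B = "{}"]) (auto simp: ker.lin_dep_def)
  then obtain A where "finite A" "ker.basis A"
    using ker.max_li_is_basis by auto
  then have "card A = 0" using ker.dim_basis dim0 by simp
  with \<open>finite A\<close> \<open>ker.basis A\<close> have "ker.span {} = kerT" by (simp add: ker.basis_def)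
  then have "kerT = {\<zero>\<^bsub>V\<^esub>}" using ker.span_empty by simp
  then show ?thesis using assms(5,6) by (auto simp: ker_def)
qed

section \<open>Persistence of a nonzerodivisor\<close>

lemma lookup_var_times_eq_0:
  fixes f :: "(var, 'k::comm_ring_1) mpoly"
  assumes "v \<notin> Poly_Mapping.keys t"
  shows "Poly_Mapping.lookup (var_poly v * f) t = 0"
proof -
  have "t \<notin> Poly_Mapping.keys (var_poly v * f)"
    using keys_times_single[of "Poly_Mapping.single v 1" 1 f] assms
    by (auto simp: keys_add_exponents)
  then show ?thesis by (simp add: in_keys_iff)
qed

lemma var_poly_nonzero [simp]: "var_poly v \<noteq> (0 :: (var, 'k::field) mpoly)"
  by (metis keys_single keys_zero one_neq_zero insert_not_empty)

lemma const_poly_sum: "const_poly (\<Sum>i\<in>A. g i) = (\<Sum>i\<in>A. const_poly (g i))"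
  by (induction A rule: infinite_finite_induct) (simp_all add: single_add)

lemma bihom_part_split_X:
  assumes "f \<in> bihom_part n m (Suc s) b" "t \<in> Poly_Mapping.keys f" "X i \<in> Poly_Mapping.keys t"
  obtains g where "g \<in> bihom_part n m s b" "i \<le> n"
    "Poly_Mapping.single t (Poly_Mapping.lookup f t) = var_poly (X i) * g"
proof -
  define t' where "t' = t - Poly_Mapping.single (X i) 1"
  have t: "t = Poly_Mapping.single (X i) 1 + t'"
    unfolding t'_def by (rule exponent_split[OF assms(3)])
  have "Poly_Mapping.keys t \<subseteq> X ` {..n} \<union> Y ` {..m}" "xdeg t = Suc s" "ydeg t = b"
    using assms(1,2) by (auto simp: bihom_part_iff)
  then have "Poly_Mapping.keys t' \<subseteq> X ` {..n} \<union> Y ` {..m}" "xdeg t' = s" "ydeg t' = b" "i \<le> n"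
    using keys_diff_exponents[of t "Poly_Mapping.single (X i) 1"] assms(3)
    by (auto simp: t t'_def[symmetric] keys_add_exponents)
  with that[of "Poly_Mapping.single t' (Poly_Mapping.lookup f t)"] show ?thesis
    using single_X_add[of "X i" t' "Poly_Mapping.lookup f t"] by (simp flip: t)
qed

text \<open>
  The assumption \<open>surjective\<close> is \<open>(R/(I, x\<^sub>0))\<^bsub>a,b\<^esub> = 0\<close>. It is separated from the injectivity of
  multiplication by \<open>x\<^sub>0\<close>, because the latter is deduced from it by comparing dimensions.
\<close>

locale x0_generating_ideal = bi_ideal n m I
  for n m :: nat and I :: "(var, 'k::field) mpoly set" +
  fixes a b :: nat
  assumes generated: "generated_up_to n m I a b"
    and surjective: "\<And>f. f \<in> bihom_part n m a b \<Longrightarrow>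
      f \<in> genideal (bi_ring n m) (I \<union> {var_poly (X 0)})"
begin

lemma I_induct [consumes 1, case_names zero add gen]:
  assumes "f \<in> I" "P 0" "\<And>g h. P g \<Longrightarrow> P h \<Longrightarrow> P (g + h)"
    and "\<And>t k g c d. Poly_Mapping.keys t \<subseteq> X ` {..n} \<union> Y ` {..m} \<Longrightarrow> g \<in> I \<Longrightarrow>
      g \<in> bihom_part n m c d \<Longrightarrow> c \<le> a \<Longrightarrow> d \<le> b \<Longrightarrow> P (Poly_Mapping.single t k * g)"
  shows "P f"
proof -
  obtain F where F: "\<And>f. f \<in> F \<Longrightarrow> \<exists>c\<le>a. \<exists>d\<le>b. f \<in> bihom_part n m c d"
    and I: "I = genideal (poly_ring (X ` {..n} \<union> Y ` {..m})) F"
    using generated by (auto simp: generated_up_to_def bi_ring_def)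
  have FR: "F \<subseteq> carrier (poly_ring (X ` {..n} \<union> Y ` {..m}))"
    using F bihom_part_carrier unfolding bi_ring_def by blast
  then have "F \<subseteq> I" unfolding I by (rule poly_ring.genideal_self)
  show ?thesis
    by (rule genideal_poly_induct[OF assms(1)[unfolded I] FR])
      (use F \<open>F \<subseteq> I\<close> assms(2-4) in blast)+
qed

lemma bidegree_part_in_I:
  assumes "f \<in> I"
  shows "bidegree_part c d f \<in> I"
  using assms
proof (induction f rule: I_induct)
  case (gen t k g c' d')
  have "Poly_Mapping.single t k \<in> bihom_part n m (xdeg t) (ydeg t)" using gen(1) by simp
  from bihom_part_mult[OF this gen(3)] gen(1,2) show ?case
    by (simp add: bidegree_part_of_bihom)
qed (simp_all add: bidegree_part_add)

text \<open>
  Generation in bidegrees at most \<open>(a, b)\<close> is used here: beyond \<open>x\<close>-degree \<open>a\<close>, a generator has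
  to be multiplied by some \<open>x\<^sub>i\<close>.
\<close>

lemma I_piece_generated:
  assumes "s \<ge> a" "f \<in> I" "f \<in> bihom_part n m (Suc s) b"
  obtains g where "\<And>i. g i \<in> I" "\<And>i. g i \<in> bihom_part n m s b"
    "f = (\<Sum>i\<le>n. var_poly (X i) * g i)"
proof -
  have "\<exists>g. (\<forall>i. g i \<in> I \<inter> bihom_part n m s b) \<and>
      bidegree_part (Suc s) b f = (\<Sum>i\<le>n. var_poly (X i) * g i)"
    using assms(2)
  proof (induction f rule: I_induct)
    case zero
    show ?case by (rule exI[of _ "\<lambda>_. 0"]) simp
  next
    case (add f1 f2)
    then obtain g1 g2 where "\<forall>i. g1 i \<in> I \<inter> bihom_part n m s b" "\<forall>i. g2 i \<in> I \<inter> bihom_part n m s b"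
      "bidegree_part (Suc s) b f1 = (\<Sum>i\<le>n. var_poly (X i) * g1 i)"
      "bidegree_part (Suc s) b f2 = (\<Sum>i\<le>n. var_poly (X i) * g2 i)"
      by blast
    then show ?case
      by (intro exI[of _ "\<lambda>i. g1 i + g2 i"])
        (simp add: bidegree_part_add distrib_left sum.distrib)
  next
    case (gen t k g c d)
    have tg: "Poly_Mapping.single t k * g \<in> bihom_part n m (xdeg t + c) (ydeg t + d)"
      using bihom_part_mult[OF bihom_part_single gen(3)] gen(1) by simp
    show ?case
    proof (cases "xdeg t + c = Suc s \<and> ydeg t + d = b")
      case True
      then have "xdeg t > 0" using gen(4) assms(1) by simp
      then obtain i t' where i: "X i \<in> Poly_Mapping.keys t" "t = Poly_Mapping.single (X i) 1 + t'"
        by (rule xdeg_pos_split)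
      have "i \<le> n" and t': "Poly_Mapping.keys t' \<subseteq> X ` {..n} \<union> Y ` {..m}"
        using gen(1) i by (auto simp: keys_add_exponents)
      define h where "h = Poly_Mapping.single t' k * g"
      have "h \<in> I" unfolding h_def using gen(2) t' by simp
      moreover have "h \<in> bihom_part n m s b"
        unfolding h_def using bihom_part_mult[OF bihom_part_single gen(3), OF t' refl refl] True
        by (simp add: i(2))
      moreover have "Poly_Mapping.single t k * g = var_poly (X i) * h"
        unfolding i(2) single_X_add h_def by (simp add: mult.assoc)
      moreover have "(\<Sum>j\<le>n. var_poly (X j) * (if j = i then h else 0)) = var_poly (X i) * h"
        using \<open>i \<le> n\<close> by (subst sum.remove[of _ i]) (auto intro!: sum.neutral)
      ultimately show ?thesis
        using tg True by (intro exI[of _ "\<lambda>j. if j = i then h else 0"])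
          (simp add: bidegree_part_of_bihom)
    next
      case False
      then have "bidegree_part (Suc s) b (Poly_Mapping.single t k * g) = 0"
        using bidegree_part_of_bihom[OF tg, of "Suc s" b] by auto
      then show ?thesis by (intro exI[of _ "\<lambda>_. 0"]) simp
    qed
  qed
  then obtain g where g: "\<And>i. g i \<in> I" "\<And>i. g i \<in> bihom_part n m s b"
    and f: "bidegree_part (Suc s) b f = (\<Sum>i\<le>n. var_poly (X i) * g i)" by auto
  show thesis
    by (rule that[OF g]) (use f bidegree_part_of_bihom[OF assms(3), of "Suc s" b] in simp)
qed

text \<open>
  The witness \<open>e\<close> has bidegree \<open>(a - 1, b)\<close>, or is zero if \<open>a = 0\<close>; the condition on
  the products \<open>x\<^sub>i e\<close> covers both cases.
\<close>

lemma x0_surjective_base: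
  assumes "f \<in> bihom_part n m a b"
  obtains e where "f - var_poly (X 0) * e \<in> I" "\<And>i. i \<le> n \<Longrightarrow> var_poly (X i) * e \<in> bihom_part n m a b"
proof -
  let ?V = "X ` {..n} \<union> Y ` {..m}"
  have "f \<in> genideal (poly_ring ?V) (I \<union> {var_poly (X 0)})"
    using surjective[OF assms] by (simp add: bi_ring_def)
  moreover have "I \<union> {var_poly (X 0)} \<subseteq> carrier (poly_ring ?V)"
    using in_carrier by auto
  ultimately have "\<exists>g\<in>I. \<exists>r\<in>carrier (poly_ring ?V). f = g + var_poly (X 0) * r"
  proof (induction f rule: genideal_poly_induct)
    case zero
    show ?case by (intro bexI[of _ 0]) auto
  next
    case (add f1 f2)
    then obtain g1 r1 g2 r2 where "g1 \<in> I" "g2 \<in> I" "r1 \<in> carrier (poly_ring ?V)"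
      "r2 \<in> carrier (poly_ring ?V)" "f1 = g1 + var_poly (X 0) * r1" "f2 = g2 + var_poly (X 0) * r2"
      by blast
    then show ?case
      by (intro bexI[of _ "g1 + g2"] bexI[of _ "r1 + r2"]) (auto simp: algebra_simps)
  next
    case (gen t c g)
    show ?case
    proof (cases "g \<in> I")
      case True
      then show ?thesis
        using gen(1) by (intro bexI[of _ "Poly_Mapping.single t c * g"] bexI[of _ 0]) auto
    next
      case False
      then show ?thesis
        using gen by (intro bexI[of _ 0] bexI[of _ "Poly_Mapping.single t c"])
          (auto simp: mult.commute)
    qed
  qed
  then obtain g r where g: "g \<in> I" and r: "r \<in> carrier (poly_ring ?V)" and f: "f = g + var_poly (X 0) * r"
    by blast
  have "\<exists>e. bidegree_part a b (var_poly (X 0) * r) = var_poly (X 0) * e \<and>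
      (\<forall>i\<le>n. var_poly (X i) * e \<in> bihom_part n m a b)"
  proof (rule poly_additive_induct[where f = r])
    show "\<exists>e. bidegree_part a b (var_poly (X 0) * 0) = var_poly (X 0) * e \<and>
      (\<forall>i\<le>n. var_poly (X i) * e \<in> bihom_part n m a b)"
      by (intro exI[of _ 0]) simp
  next
    fix r1 r2 :: "(var, 'k) mpoly"
    assume "\<exists>e. bidegree_part a b (var_poly (X 0) * r1) = var_poly (X 0) * e \<and>
      (\<forall>i\<le>n. var_poly (X i) * e \<in> bihom_part n m a b)"
      and "\<exists>e. bidegree_part a b (var_poly (X 0) * r2) = var_poly (X 0) * e \<and>
      (\<forall>i\<le>n. var_poly (X i) * e \<in> bihom_part n m a b)"
    then obtain e1 e2 where "bidegree_part a b (var_poly (X 0) * r1) = var_poly (X 0) * e1"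
      "\<forall>i\<le>n. var_poly (X i) * e1 \<in> bihom_part n m a b"
      "bidegree_part a b (var_poly (X 0) * r2) = var_poly (X 0) * e2"
      "\<forall>i\<le>n. var_poly (X i) * e2 \<in> bihom_part n m a b" by blast
    then show "\<exists>e. bidegree_part a b (var_poly (X 0) * (r1 + r2)) = var_poly (X 0) * e \<and>
      (\<forall>i\<le>n. var_poly (X i) * e \<in> bihom_part n m a b)"
      by (intro exI[of _ "e1 + e2"]) (simp add: distrib_left bidegree_part_add)
  next
    fix t assume "t \<in> Poly_Mapping.keys r"
    then have t: "Poly_Mapping.keys t \<subseteq> ?V" using r by (simp add: poly_ring_carrier)
    let ?c = "Poly_Mapping.lookup r t"
    have x: "var_poly (X i) * Poly_Mapping.single t ?c \<in> bihom_part n m (Suc (xdeg t)) (ydeg t)"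
      if "i \<le> n" for i using t that by simp
    show "\<exists>e. bidegree_part a b (var_poly (X 0) * Poly_Mapping.single t ?c) = var_poly (X 0) * e \<and>
      (\<forall>i\<le>n. var_poly (X i) * e \<in> bihom_part n m a b)"
    proof (cases "Suc (xdeg t) = a \<and> ydeg t = b")
      case True
      then show ?thesis
        using x bidegree_part_of_bihom[OF x[of 0], of a b]
        by (intro exI[of _ "Poly_Mapping.single t ?c"]) auto
    next
      case False
      then have "bidegree_part a b (var_poly (X 0) * Poly_Mapping.single t ?c) = 0"
        using bidegree_part_of_bihom[OF x[of 0], of a b] by auto
      then show ?thesis by (intro exI[of _ 0]) simp
    qed
  qed
  then obtain e where e: "bidegree_part a b (var_poly (X 0) * r) = var_poly (X 0) * e"
    "\<And>i. i \<le> n \<Longrightarrow> var_poly (X i) * e \<in> bihom_part n m a b" by blast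
  have "f = bidegree_part a b g + var_poly (X 0) * e"
    using bidegree_part_of_bihom[OF assms, of a b] by (simp add: f bidegree_part_add e(1))
  then have "f - var_poly (X 0) * e \<in> I" using bidegree_part_in_I[OF g, of a b] by simp
  from that[OF this e(2)] show thesis .
qed

text \<open>Beyond \<open>x\<close>-degree \<open>a\<close>, every term is a multiple of a term of smaller \<open>x\<close>-degree.\<close>

lemma x0_surjective:
  assumes "s \<ge> a" "f \<in> bihom_part n m s b"
  shows "\<exists>e. f - var_poly (X 0) * e \<in> I \<and> (\<forall>i\<le>n. var_poly (X i) * e \<in> bihom_part n m s b)"
  using assms
proof (induction s arbitrary: f rule: dec_induct)
  case base
  then show ?case using x0_surjective_base by metis
next
  case (step s)
  let ?P = "\<lambda>f. \<exists>e. f - var_poly (X 0) * e \<in> I \<and>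
    (\<forall>i\<le>n. var_poly (X i) * e \<in> bihom_part n m (Suc s) b)"
  show ?case
  proof (rule poly_additive_induct[where f = f and P = ?P])
    show "?P 0" by (intro exI[of _ 0]) simp
  next
    fix f1 f2 :: "(var, 'k) mpoly"
    assume "?P f1" "?P f2"
    then obtain e1 e2 where "f1 - var_poly (X 0) * e1 \<in> I" "f2 - var_poly (X 0) * e2 \<in> I"
      and e: "\<forall>i\<le>n. var_poly (X i) * e1 \<in> bihom_part n m (Suc s) b"
      "\<forall>i\<le>n. var_poly (X i) * e2 \<in> bihom_part n m (Suc s) b" by blast
    from add[OF this(1,2)] have "f1 + f2 - var_poly (X 0) * (e1 + e2) \<in> I"
      by (simp add: algebra_simps)
    with e show "?P (f1 + f2)" by (intro exI[of _ "e1 + e2"]) (simp add: distrib_left)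
  next
    fix t assume t: "t \<in> Poly_Mapping.keys f"
    then have "xdeg t > 0" using step.prems by (simp add: bihom_part_iff)
    then obtain j where "X j \<in> Poly_Mapping.keys t" by (rule xdeg_pos_split)
    then obtain g where g: "g \<in> bihom_part n m s b" and "j \<le> n"
      and tg: "Poly_Mapping.single t (Poly_Mapping.lookup f t) = var_poly (X j) * g"
      using bihom_part_split_X[OF step.prems t] by blast
    obtain e where e: "g - var_poly (X 0) * e \<in> I" "\<forall>i\<le>n. var_poly (X i) * e \<in> bihom_part n m s b"
      using step.IH[OF g] by blast
    have "var_poly (X j) * (g - var_poly (X 0) * e) \<in> I"
      using e(1) \<open>j \<le> n\<close> by (intro ideal_mult) simp_all
    moreover have "var_poly (X i) * (var_poly (X j) * e) \<in> bihom_part n m (Suc s) b" if "i \<le> n" for i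
      using e(2) that bihom_part_X_mult[OF \<open>j \<le> n\<close>, of "var_poly (X i) * e" m s b]
      by (simp add: mult.left_commute)
    ultimately show "?P (Poly_Mapping.single t (Poly_Mapping.lookup f t))"
      unfolding tg by (intro exI[of _ "var_poly (X j) * e"]) (simp add: algebra_simps)
  qed
qed

lemma x0_surjective_Suc:
  assumes "s \<ge> a" "f \<in> bihom_part n m (Suc s) b"
  obtains e where "e \<in> bihom_part n m s b" "f - var_poly (X 0) * e \<in> I"
proof -
  obtain e where e: "f - var_poly (X 0) * e \<in> I" "var_poly (X 0) * e \<in> bihom_part n m (Suc s) b"
    using x0_surjective[of "Suc s" f] assms by auto
  have "Poly_Mapping.keys t \<subseteq> X ` {..n} \<union> Y ` {..m} \<and> xdeg t = s \<and> ydeg t = b"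
    if "t \<in> Poly_Mapping.keys e" for t
  proof -
    have "Poly_Mapping.single (X 0) 1 + t \<in> Poly_Mapping.keys (var_poly (X 0) * e)"
      using that by (simp add: in_keys_iff lookup_times_monom)
    with e(2) show ?thesis
      by (auto simp: bihom_part_iff keys_add_exponents plus_1_eq_Suc dest!: bspec)
  qed
  then have "e \<in> bihom_part n m s b" by (simp add: bihom_part_iff)
  from that[OF this e(1)] show thesis .
qed

end

locale admissible_ideal = x0_generating_ideal +
  assumes injective: "\<And>f. f \<in> bihom_part n m a b \<Longrightarrow> var_poly (X 0) * f \<in> I \<Longrightarrow> f \<in> I"
begin

text \<open>
  If \<open>x\<^sub>0 f \<in> I\<close> has \<open>x\<close>-degree \<open>s + 2\<close>, then \<open>x\<^sub>0 f = \<Sum>\<^sub>i x\<^sub>i g\<^sub>i\<close> with all \<open>g\<^sub>i\<close> in \<open>I\<close>, and the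
  summands are eliminated from the last one on. As \<open>x\<^sub>k g\<^sub>k\<close> lies in the ideal of \<open>x\<^sub>0, \<dots>, x\<^bsub>k-1\<^esub>\<close>,
  so does \<open>g\<^sub>k\<close>; replacing its coefficients by multiples of \<open>x\<^sub>0\<close> modulo \<open>I\<close> gives
  \<open>g\<^sub>k = x\<^sub>0 p + \<Sum>\<^bsub>i<k\<^esub> x\<^sub>i q\<^sub>i\<close> with all \<open>q\<^sub>i\<close> in \<open>I\<close>. Then \<open>x\<^sub>0 p \<in> I\<close>, hence \<open>p \<in> I\<close> by induction on
  the degree, and passing from \<open>f\<close> to \<open>f - x\<^sub>k p\<close> shortens the sum.
\<close>

lemma x0_injective:
  assumes "s \<ge> a" "f \<in> bihom_part n m s b" "var_poly (X 0) * f \<in> I"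
  shows "f \<in> I"
  using assms
proof (induction s arbitrary: f rule: dec_induct)
  case base
  then show ?case by (rule injective)
next
  case (step s)
  have elim: "f \<in> I"
    if "k \<le> Suc n" "f \<in> bihom_part n m (Suc s) b" "\<And>i. g i \<in> I" "\<And>i. g i \<in> bihom_part n m (Suc s) b"
      "var_poly (X 0) * f = (\<Sum>i<k. var_poly (X i) * g i)" for k f g
    using that
  proof (induction k arbitrary: f g)
    case 0
    then show ?case by simp
  next
    case (Suc k)
    have kn: "k \<le> n" using Suc.prems(1) by simp
    show ?case
    proof (cases "k = 0")
      case True
      then have "var_poly (X 0) * f = var_poly (X 0) * g 0" using Suc.prems(5) by simp
      then show ?thesis using Suc.prems(3) by simp
    next
      case False
      have xg: "var_poly (X k) * g k = var_poly (X 0) * f - (\<Sum>i<k. var_poly (X i) * g i)"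
        using Suc.prems(5) by simp
      \<comment> \<open>\<open>x\<^sub>k\<close> is not a zero divisor modulo the monomial ideal of \<open>x\<^sub>0, \<dots>, x\<^bsub>k-1\<^esub>\<close>.\<close>
      have div: "\<exists>i<k. X i \<in> Poly_Mapping.keys t" if t: "t \<in> Poly_Mapping.keys (g k)" for t
      proof (rule ccontr)
        let ?t = "Poly_Mapping.single (X k) 1 + t"
        assume "\<not> (\<exists>i<k. X i \<in> Poly_Mapping.keys t)"
        then have "X i \<notin> Poly_Mapping.keys ?t" if "i < k" for i
          using that by (auto simp: keys_add_exponents)
        then have "Poly_Mapping.lookup (var_poly (X k) * g k) ?t = 0"
          unfolding xg using False by (simp add: lookup_minus lookup_sum lookup_var_times_eq_0)
        then show False using t by (simp add: lookup_times_monom in_keys_iff)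
      qed
      let ?P = "\<lambda>h. \<exists>p q. p \<in> bihom_part n m s b \<and> (\<forall>i. q i \<in> I \<inter> bihom_part n m s b) \<and>
        h = var_poly (X 0) * p + (\<Sum>i<k. var_poly (X i) * q i)"
      have "?P (g k)"
      proof (rule poly_additive_induct[where f = "g k" and P = ?P])
        show "?P 0" by (intro exI[of _ 0] exI[of _ "\<lambda>_. 0"]) simp
      next
        fix h1 h2 assume "?P h1" "?P h2"
        then obtain p1 q1 p2 q2 where "p1 \<in> bihom_part n m s b" "p2 \<in> bihom_part n m s b"
          "\<forall>i. q1 i \<in> I \<inter> bihom_part n m s b" "\<forall>i. q2 i \<in> I \<inter> bihom_part n m s b"
          "h1 = var_poly (X 0) * p1 + (\<Sum>i<k. var_poly (X i) * q1 i)"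
          "h2 = var_poly (X 0) * p2 + (\<Sum>i<k. var_poly (X i) * q2 i)" by blast
        then show "?P (h1 + h2)"
          by (intro exI[of _ "p1 + p2"] exI[of _ "\<lambda>i. q1 i + q2 i"])
            (simp add: distrib_left sum.distrib)
      next
        fix t assume t: "t \<in> Poly_Mapping.keys (g k)"
        obtain i where i: "i < k" "X i \<in> Poly_Mapping.keys t" using div[OF t] by blast
        obtain h where h: "h \<in> bihom_part n m s b" "i \<le> n"
          "Poly_Mapping.single t (Poly_Mapping.lookup (g k) t) = var_poly (X i) * h"
          using bihom_part_split_X[OF Suc.prems(4) t i(2)] by blast
        obtain e where e: "h - var_poly (X 0) * e \<in> I"
          "\<And>i. i \<le> n \<Longrightarrow> var_poly (X i) * e \<in> bihom_part n m s b"
          using x0_surjective[OF step.hyps(1) h(1)] by blast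
        let ?q = "\<lambda>j. if j = i then h - var_poly (X 0) * e else 0"
        have "(\<Sum>j<k. var_poly (X j) * ?q j) = var_poly (X i) * (h - var_poly (X 0) * e)"
          using i(1) by (subst sum.remove[of _ i]) (auto intro!: sum.neutral)
        moreover have "h - var_poly (X 0) * e \<in> bihom_part n m s b"
          using h(1) e(2)[of 0] by simp
        ultimately show "?P (Poly_Mapping.single t (Poly_Mapping.lookup (g k) t))"
          using e h by (intro exI[of _ "var_poly (X i) * e"] exI[of _ ?q]) (auto simp: algebra_simps)
      qed
      then obtain p q where p: "p \<in> bihom_part n m s b"
        and q: "\<And>i. q i \<in> I" "\<And>i. q i \<in> bihom_part n m s b"
        and gk: "g k = var_poly (X 0) * p + (\<Sum>i<k. var_poly (X i) * q i)" by auto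
      have "(\<Sum>i<k. var_poly (X i) * q i) \<in> I"
        using kn q(1) by (intro sum ideal_mult) simp_all
      with Suc.prems(3)[of k] have "g k - (\<Sum>i<k. var_poly (X i) * q i) \<in> I" by (rule diff)
      then have "p \<in> I" using step.IH[OF p] by (simp add: gk)
      \<comment> \<open>The multiples \<open>x\<^sub>k q\<^sub>i\<close> are absorbed into the remaining summands.\<close>
      have "f - var_poly (X k) * p \<in> I"
      proof (rule Suc.IH)
        show "f - var_poly (X k) * p \<in> bihom_part n m (Suc s) b"
          using Suc.prems(2) p kn by simp
        show "g i + var_poly (X k) * q i \<in> I" for i
          using Suc.prems(3) q(1) kn ideal_mult by simp
        show "g i + var_poly (X k) * q i \<in> bihom_part n m (Suc s) b" for i
          using Suc.prems(4) q(2) kn by simp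
        show "var_poly (X 0) * (f - var_poly (X k) * p) =
            (\<Sum>i<k. var_poly (X i) * (g i + var_poly (X k) * q i))"
          using Suc.prems(5)
          by (simp add: gk algebra_simps sum.distrib sum_distrib_left)
      qed (use kn in simp)
      moreover have "var_poly (X k) * p \<in> I"
        using \<open>p \<in> I\<close> kn by (intro ideal_mult) simp_all
      ultimately show ?thesis using add by fastforce
    qed
  qed
  have x0f: "var_poly (X 0) * f \<in> bihom_part n m (Suc (Suc s)) b" using step.prems by simp
  obtain g where g: "\<And>i. g i \<in> I" "\<And>i. g i \<in> bihom_part n m (Suc s) b"
    and x0f_eq: "var_poly (X 0) * f = (\<Sum>i\<le>n. var_poly (X i) * g i)"
    using I_piece_generated[OF le_SucI[OF step.hyps(1)] step.prems(2) x0f] by blast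
  show ?case
    by (rule elim[OF order_refl step.prems(1) g]) (use x0f_eq in \<open>simp only: lessThan_Suc_atMost\<close>)
qed

lemma x0_power_injective:
  assumes "s \<ge> a" "f \<in> bihom_part n m s b" "var_poly (X 0) ^ d * f \<in> I"
  shows "f \<in> I"
  using assms(3)
proof (induction d)
  case (Suc d)
  have "var_poly (X 0) ^ d * f \<in> I"
    by (rule x0_injective[of "d + s"]) (use assms Suc.prems in \<open>simp_all add: mult.assoc\<close>)
  then show ?case by (rule Suc.IH)
qed simp

end

section \<open>From Hilbert functions to multiplication by \<open>x\<^sub>0\<close>\<close>

lemma (in vectorspace) dim_zero_imp_trivial:
  assumes "fin_dim" "dim = 0"
  shows "carrier V = {\<zero>\<^bsub>V\<^esub>}"
proof -
  obtain A where A: "finite A" "basis A" using finite_basis_exists[OF assms(1)] by blast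
  then have "A = {}" using dim_basis assms(2) by simp
  then show ?thesis using A(2) span_empty by (simp add: basis_def)
qed

lemma (in bi_ideal) mult_map_cls:
  "f \<in> carrier (bi_ring n m) \<Longrightarrow> g \<in> carrier (bi_ring n m) \<Longrightarrow> mult_map n m I g (cls f) = cls (g * f)"
  by (simp add: mult_map_def cls_mult)

text \<open>
  The finite-dimensionality of \<open>(R/J)\<^bsub>a,b\<^esub>\<close>, without which a zero dimension says nothing, is
  inherited from \<open>(R/I)\<^bsub>a,b\<^esub>\<close>.
\<close>

lemma HF_zero_imp_mem:
  fixes I J :: "(var, 'k::field) mpoly set"
  assumes I: "bi_ideal n m I" and J: "bi_ideal n m J" and "I \<subseteq> J"
    and fin: "vectorspace.fin_dim class_ring (quot_part n m I a b)"
    and HF: "HF n m J a b = 0" and f: "f \<in> bihom_part n m a b"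
  shows "f \<in> J"
proof -
  interpret I: bi_ideal n m I by fact
  interpret J: bi_ideal n m J by fact
  define T where "T = (\<lambda>C. J.cls (SOME g. g \<in> bihom_part n m a b \<and> I.cls g = C))"
  have T: "T (I.cls g) = J.cls g" if g: "g \<in> bihom_part n m a b" for g
  proof -
    let ?h = "SOME h. h \<in> bihom_part n m a b \<and> I.cls h = I.cls g"
    have h: "?h \<in> bihom_part n m a b \<and> I.cls ?h = I.cls g"
      by (rule someI[of _ g]) (use g in simp)
    then have "?h - g \<in> I" using I.cls_eq_iff_bihom g by blast
    then show ?thesis
      unfolding T_def using J.cls_eq_iff_bihom[of ?h a b g] h g \<open>I \<subseteq> J\<close> by auto
  qed
  interpret T: linear_map class_ring "I.piece a b" "J.piece a b" T
    by (rule piece_linear_mapI[OF I J, where g = "\<lambda>f. f"]) (simp_all add: T)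
  have "T ` carrier (I.piece a b) = carrier (J.piece a b)"
    by (auto simp: I.piece_carrier J.piece_carrier T image_image)
  then have "T.W.fin_dim" using T.rank_nullity_main(2) fin by blast
  then have "carrier (J.piece a b) = {\<zero>\<^bsub>J.piece a b\<^esub>}"
    by (rule T.W.dim_zero_imp_trivial) (use HF in \<open>simp add: HF_def\<close>)
  then have "J.cls f = J.cls 0"
    using J.cls_in_piece[OF f] by (simp add: J.piece_zero)
  then show ?thesis using J.cls_eq_iff_bihom[OF f bihom_part_zero] by simp
qed

text \<open>
  The vanishing of the Hilbert function of \<open>R/(I, x\<^sub>0)\<close> says that multiplication by \<open>x\<^sub>0\<close> is onto,
  and the equality of the two values for \<open>R/I\<close> then makes it injective.
\<close>

lemma admissible_idealI:
  fixes I :: "(var, 'k::field) mpoly set"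
  assumes I: "bihomogeneous_ideal n m I" and adm: "admissible n m I a b"
    and x0: "admissible_linear_form n m I a b (var_poly (X 0))"
    and fin: "vectorspace.fin_dim class_ring (quot_part n m I a b)"
  shows "admissible_ideal n m I a b"
proof -
  interpret bi_ideal n m I
    using I by (simp add: bi_ideal_def bihomogeneous_ideal_def)
  let ?J = "genideal (bi_ring n m) (I \<union> {var_poly (X 0)})"
  have sub: "I \<union> {var_poly (X 0)} \<subseteq> carrier (bi_ring n m)"
    using ideal_in_carrier by auto
  have J: "bi_ideal n m ?J"
    using sub unfolding bi_ideal_def bi_ring_def by (rule poly_ring.genideal_ideal)
  have IJ: "I \<subseteq> ?J"
    using poly_ring.genideal_self sub unfolding bi_ring_def by blast
  interpret x0_generating_ideal n m I a b
  proof
    show "generated_up_to n m I a b" using adm by (simp add: admissible_def)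
    show "f \<in> ?J" if "f \<in> bihom_part n m a b" for f
      by (rule HF_zero_imp_mem[OF bi_ideal_axioms J IJ fin _ that])
        (use x0 in \<open>simp add: admissible_linear_form_def\<close>)
  qed
  let ?T = "mult_map n m I (var_poly (X 0))"
  have T: "?T (cls f) = cls (var_poly (X 0) * f)" if "f \<in> bihom_part n m a b" for f
    using that by (simp add: mult_map_cls bihom_part_carrier)
  have lin: "linear_map class_ring (piece a b) (piece (Suc a) b) ?T"
    by (rule piece_linear_mapI[OF bi_ideal_axioms bi_ideal_axioms, where g = "\<lambda>f. var_poly (X 0) * f"])
      (simp_all add: T distrib_left mult.left_commute)
  have surj: "?T ` carrier (piece a b) = carrier (piece (Suc a) b)"
  proof -
    have "\<exists>e\<in>bihom_part n m a b. cls f = cls (var_poly (X 0) * e)"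
      if f: "f \<in> bihom_part n m (Suc a) b" for f
    proof -
      obtain e where e: "e \<in> bihom_part n m a b" "f - var_poly (X 0) * e \<in> I"
        using x0_surjective_Suc[OF order_refl f] by blast
      then show ?thesis using cls_eq_iff_bihom[OF f, of "var_poly (X 0) * e"] by auto
    qed
    then show ?thesis by (auto simp: piece_carrier T image_iff)
  qed
  show ?thesis
  proof unfold_locales
    fix f assume f: "f \<in> bihom_part n m a b" and xf: "var_poly (X 0) * f \<in> I"
    have xf_bihom: "var_poly (X 0) * f \<in> bihom_part n m (Suc a) b" using f by simp
    have "?T (cls f) = \<zero>\<^bsub>piece (Suc a) b\<^esub>"
      using cls_eq_iff_bihom[OF xf_bihom bihom_part_zero] xf by (simp add: T[OF f] piece_zero)
    then have "cls f = \<zero>\<^bsub>piece a b\<^esub>"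
      using x0 by (intro linear_map_surj_imp_inj[OF lin fin surj _ cls_in_piece[OF f]])
        (simp_all add: admissible_linear_form_def HF_def Suc_eq_plus1)
    then show "f \<in> I" using cls_eq_iff_bihom[OF f bihom_part_zero] by (simp add: piece_zero)
  qed
qed

section \<open>Coordinates and multiplication matrices\<close>

locale admissible_basis = admissible_ideal n m I a b
  for n m :: nat and I :: "(var, 'k::field) mpoly set" and a b :: nat +
  fixes B :: "(var, 'k) mpoly set list"
  assumes distinct_B: "distinct B"
    and basis_B: "vectorspace.basis class_ring (quot_part n m I a b) (set B)"
begin

sublocale V: vectorspace class_ring "piece a b"
  by (rule piece_vectorspace)

abbreviation D :: nat where "D \<equiv> length B"

text \<open>
  Coordinate vectors are handled through the polynomials \<open>lift c\<close> that represent them, so that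
  everything below is a congruence modulo \<open>I\<close> between polynomials.
\<close>

definition rep :: "nat \<Rightarrow> (var, 'k) mpoly" where
  "rep j = (SOME f. f \<in> bihom_part n m a b \<and> cls f = B ! j)"

lemma rep:
  assumes "j < D"
  shows "rep j \<in> bihom_part n m a b" "cls (rep j) = B ! j"
proof -
  have "B ! j \<in> carrier (piece a b)"
    using basis_B assms by (auto simp: V.basis_def)
  then have "\<exists>f. f \<in> bihom_part n m a b \<and> cls f = B ! j" by (auto simp: piece_carrier)
  from someI_ex[OF this] show "rep j \<in> bihom_part n m a b" "cls (rep j) = B ! j"
    unfolding rep_def by auto
qed

definition lift :: "'k vec \<Rightarrow> (var, 'k) mpoly" where
  "lift c = (\<Sum>j<D. const_poly (c $ j) * rep j)"

lemma lift_bihom [simp]: "lift c \<in> bihom_part n m a b"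
  unfolding lift_def using rep(1) by (intro bihom_part_sum) simp

lemma cls_lift: "cls (lift c) = (\<Oplus>\<^bsub>piece a b\<^esub>i\<in>{..<D}. c $ i \<odot>\<^bsub>piece a b\<^esub> (B ! i))"
proof -
  have "cls (lift c) = (\<Oplus>\<^bsub>piece a b\<^esub>i\<in>{..<D}. c $ i \<odot>\<^bsub>piece a b\<^esub> cls (rep i))"
    unfolding lift_def using rep(1) by (subst piece_finsum) simp_all
  also have "\<dots> = (\<Oplus>\<^bsub>piece a b\<^esub>i\<in>{..<D}. c $ i \<odot>\<^bsub>piece a b\<^esub> (B ! i))"
    using rep cls_in_piece
    by (intro V.finsum_cong2) (auto simp: class_ring_simps simp flip: rep(2) intro!: V.smult_closed)
  finally show ?thesis .
qed

lemma lincomb_B: "V.lincomb g (set B) = cls (lift (vec D (\<lambda>i. g (B ! i))))"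
proof -
  have inj: "inj_on ((!) B) {..<D}" using distinct_B by (simp add: inj_on_nth)
  have B: "(!) B ` {..<D} = set B" by (auto simp: in_set_conv_nth)
  have "(\<Oplus>\<^bsub>piece a b\<^esub>v\<in>(!) B ` {..<D}. g v \<odot>\<^bsub>piece a b\<^esub> v) =
      (\<Oplus>\<^bsub>piece a b\<^esub>i\<in>{..<D}. g (B ! i) \<odot>\<^bsub>piece a b\<^esub> (B ! i))"
    using basis_B B
    by (intro V.finsum_reindex inj) (auto simp: V.basis_def class_ring_simps intro!: V.smult_closed)
  also have "\<dots> = cls (lift (vec D (\<lambda>i. g (B ! i))))"
    unfolding cls_lift using rep cls_in_piece
    by (intro V.finsum_cong2) (auto simp: class_ring_simps simp flip: rep(2) intro!: V.smult_closed)
  finally show ?thesis by (simp add: V.lincomb_def B)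
qed

lemma lift_surjective:
  assumes "f \<in> bihom_part n m a b"
  obtains c where "c \<in> carrier_vec D" "f - lift c \<in> I"
proof -
  have "set B \<subseteq> carrier (piece a b)" "V.span (set B) = carrier (piece a b)"
    using basis_B by (auto simp: V.basis_def)
  then have "cls f \<in> {V.lincomb g (set B) | g. g \<in> set B \<rightarrow> carrier class_ring}"
    using V.finite_span[of "set B"] cls_in_piece[OF assms] by auto
  then obtain g where "cls f = cls (lift (vec D (\<lambda>i. g (B ! i))))"
    by (auto simp: lincomb_B)
  with cls_eq_iff_bihom[OF assms lift_bihom] that show thesis by (metis vec_carrier)
qed

lemma lift_injective:
  assumes "c \<in> carrier_vec D" "lift c \<in> I"
  shows "c = 0\<^sub>v D"
proof -
  define g where "g = (\<lambda>v. c $ (THE i. i < D \<and> B ! i = v))"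
  have g: "g (B ! i) = c $ i" if "i < D" for i
  proof -
    have "(THE j. j < D \<and> B ! j = B ! i) = i"
      using that distinct_B by (intro the_equality) (auto simp: nth_eq_iff_index_eq)
    then show ?thesis by (simp add: g_def)
  qed
  have "vec D (\<lambda>i. g (B ! i)) = c"
    using assms(1) by (intro eq_vecI) (auto simp: g)
  then have "V.lincomb g (set B) = \<zero>\<^bsub>piece a b\<^esub>"
    using cls_eq_iff_bihom[OF lift_bihom[of c] bihom_part_zero] assms(2)
    by (simp add: lincomb_B piece_zero)
  then have "g \<in> set B \<rightarrow> {\<zero>\<^bsub>class_ring\<^esub>}"
    using basis_B by (intro V.not_lindepD[of "set B"]) (auto simp: V.basis_def class_ring_simps)
  then have "c $ i = 0" if "i < D" for i
    using that g[OF that] nth_mem[OF that] by (auto simp: class_ring_simps Pi_iff)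
  with assms(1) show ?thesis by (intro eq_vecI) auto
qed

lemma lift_minus:
  assumes "c \<in> carrier_vec D" "d \<in> carrier_vec D"
  shows "lift (c - d) = lift c - lift d"
  using assms unfolding lift_def
  by (simp add: sum_subtractf[symmetric] left_diff_distrib single_diff)

lemma lift_eqI:
  assumes "c \<in> carrier_vec D" "d \<in> carrier_vec D" "lift c - lift d \<in> I"
  shows "c = d"
proof -
  have "c - d = 0\<^sub>v D"
    using assms by (intro lift_injective) (auto simp: lift_minus)
  then have "(c - d) $ i = 0" if "i < D" for i using that by simp
  with assms(1,2) show ?thesis by (intro eq_vecI) auto
qed

lemma coords_cls:
  assumes f: "f \<in> bihom_part n m a b"
  shows "coords (piece a b) B (cls f) \<in> carrier_vec D" "f - lift (coords (piece a b) B (cls f)) \<in> I"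
proof -
  have iff: "(\<Oplus>\<^bsub>piece a b\<^esub>i\<in>{..<D}. c $ i \<odot>\<^bsub>piece a b\<^esub> (B ! i)) = cls f \<longleftrightarrow> f - lift c \<in> I" for c
    unfolding cls_lift[symmetric] using cls_eq_iff_bihom[OF f lift_bihom] by metis
  obtain c where c: "c \<in> carrier_vec D" "f - lift c \<in> I" using lift_surjective[OF f] .
  have "coords (piece a b) B (cls f) = c"
    unfolding coords_def iff
  proof (rule the_equality)
    fix d assume d: "d \<in> carrier_vec D \<and> f - lift d \<in> I"
    have "lift d - lift c = (f - lift c) - (f - lift d)" by simp
    also have "\<dots> \<in> I" by (rule diff) (use c(2) d in auto)
    finally show "d = c" using d c(1) by (intro lift_eqI) auto
  qed (use c in simp)
  with c show "coords (piece a b) B (cls f) \<in> carrier_vec D"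
    "f - lift (coords (piece a b) B (cls f)) \<in> I" by simp_all
qed

abbreviation M :: "nat \<Rightarrow> 'k mat" where "M \<equiv> mult_matrix n m I a b B"

lemma M_carrier [simp]: "M i \<in> carrier_mat D D"
  by (simp add: mult_matrix_def matrix_of_map_def)

text \<open>The inverse of multiplication by \<open>x\<^sub>0\<close> is removed by multiplying with \<open>x\<^sub>0\<close>.\<close>

lemma M_column:
  assumes i: "i \<le> n" and j: "j < D"
  shows "var_poly (X 0) * lift (col (M i) j) - var_poly (X i) * rep j \<in> I"
proof -
  let ?T = "mult_map n m I (var_poly (X 0))"
  let ?xr = "var_poly (X i) * rep j"
  define w where "w = inv_into (carrier (piece a b)) ?T (mult_map n m I (var_poly (X i)) (B ! j))"
  have xr: "?xr \<in> bihom_part n m (Suc a) b" using rep(1)[OF j] i by simp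
  have xB: "mult_map n m I (var_poly (X i)) (B ! j) = cls ?xr"
    using mult_map_cls[OF bihom_part_carrier[OF rep(1)[OF j]] var_poly_carrier(1)[OF i]] rep(2)[OF j]
    by simp
  have T: "?T (cls g) = cls (var_poly (X 0) * g)" if "g \<in> bihom_part n m a b" for g
    using that by (simp add: mult_map_cls bihom_part_carrier)
  obtain e where e: "e \<in> bihom_part n m a b" "?xr - var_poly (X 0) * e \<in> I"
    using x0_surjective_Suc[OF order_refl xr] .
  then have "cls ?xr = ?T (cls e)"
    using cls_eq_iff_bihom[OF xr, of "var_poly (X 0) * e"] by (simp add: T)
  then have "cls ?xr \<in> ?T ` carrier (piece a b)" using e(1) by simp
  then have w: "w \<in> carrier (piece a b)" "?T w = cls ?xr"
    unfolding w_def xB by (rule inv_into_into, rule f_inv_into_f)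
  obtain g where g: "g \<in> bihom_part n m a b" "w = cls g" using w(1) by (auto simp: piece_carrier)
  have "col (M i) j = coords (piece a b) B w"
    using j coords_cls(1)[OF g(1)] g(2)
    by (intro eq_vecI) (auto simp: mult_matrix_def matrix_of_map_def w_def)
  then have "g - lift (col (M i) j) \<in> I"
    using coords_cls(2)[OF g(1)] g(2) by simp
  then have "var_poly (X 0) * (g - lift (col (M i) j)) \<in> I"
    by (rule ideal_mult) simp
  moreover have "var_poly (X 0) * g - ?xr \<in> I"
    using w(2) cls_eq_iff_bihom[OF _ xr, of "var_poly (X 0) * g"] g by (simp add: T)
  ultimately have "(var_poly (X 0) * g - ?xr) - var_poly (X 0) * (g - lift (col (M i) j)) \<in> I"
    by (rule diff[rotated])
  then show ?thesis by (simp add: algebra_simps)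
qed

lemma lift_mult_mat_vec:
  assumes "A \<in> carrier_mat D D" "c \<in> carrier_vec D"
  shows "lift (A *\<^sub>v c) = (\<Sum>j<D. const_poly (c $ j) * lift (col A j))"
proof -
  have "lift (A *\<^sub>v c) = (\<Sum>i<D. \<Sum>j<D. const_poly (A $$ (i, j) * c $ j) * rep i)"
    unfolding lift_def
  proof (rule sum.cong)
    fix i assume "i \<in> {..<D}"
    then have "(A *\<^sub>v c) $ i = (\<Sum>j<D. A $$ (i, j) * c $ j)"
      using assms by (simp add: scalar_prod_def lessThan_atLeast0)
    then show "const_poly ((A *\<^sub>v c) $ i) * rep i = (\<Sum>j<D. const_poly (A $$ (i, j) * c $ j) * rep i)"
      by (simp add: sum_distrib_right const_poly_sum)
  qed simp
  also have "\<dots> = (\<Sum>j<D. \<Sum>i<D. const_poly (A $$ (i, j) * c $ j) * rep i)"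
    by (rule sum.swap)
  also have "\<dots> = (\<Sum>j<D. const_poly (c $ j) * lift (col A j))"
    unfolding lift_def sum_distrib_left using assms(1)
    by (intro sum.cong) (simp_all add: mult_single mult.assoc[symmetric] mult.commute)
  finally show ?thesis .
qed

lemma M_lift:
  assumes "i \<le> n" "c \<in> carrier_vec D"
  shows "var_poly (X 0) * lift (M i *\<^sub>v c) - var_poly (X i) * lift c \<in> I"
proof -
  have "var_poly (X 0) * lift (M i *\<^sub>v c) - var_poly (X i) * lift c =
      (\<Sum>j<D. const_poly (c $ j) * (var_poly (X 0) * lift (col (M i) j) - var_poly (X i) * rep j))"
    unfolding lift_mult_mat_vec[OF M_carrier assms(2)] lift_def[of c]
    by (simp add: sum_distrib_left sum_subtractf[symmetric] algebra_simps)
  also have "\<dots> \<in> I"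
    using M_column[OF assms(1)] by (intro sum ideal_mult) simp_all
  finally show ?thesis .
qed

end

section \<open>Matrices of monomials\<close>

definition xmono :: "nat \<Rightarrow> (nat \<Rightarrow>\<^sub>0 nat) \<Rightarrow> (var, 'k::comm_ring_1) mpoly" where
  "xmono n t = (\<Prod>i=1..n. var_poly (X i) ^ Poly_Mapping.lookup t i)"

definition tdeg :: "nat \<Rightarrow> (nat \<Rightarrow>\<^sub>0 nat) \<Rightarrow> nat" where
  "tdeg n t = (\<Sum>i=1..n. Poly_Mapping.lookup t i)"

lemma xmono_add: "xmono n (s + t) = xmono n s * xmono n t"
  by (simp add: xmono_def lookup_add power_add prod.distrib)

lemma tdeg_add: "tdeg n (s + t) = tdeg n s + tdeg n t"
  by (simp add: tdeg_def lookup_add sum.distrib)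

lemma xmono_bihom: "xmono n t \<in> bihom_part n m (tdeg n t) 0"
proof -
  have "(\<Prod>i\<in>A. var_poly (X i) ^ Poly_Mapping.lookup t i) \<in>
      bihom_part n m (\<Sum>i\<in>A. Poly_Mapping.lookup t i) 0" if "finite A" "A \<subseteq> {..n}" for A
    using that
  proof (induction A rule: finite_induct)
    case empty
    show ?case using bihom_part_const[of 1] by simp
  next
    case (insert i A)
    have "var_poly (X i) ^ Poly_Mapping.lookup t i * const_poly 1 \<in>
        bihom_part n m (Poly_Mapping.lookup t i + 0) 0"
      using insert.prems by (intro bihom_part_X_power_mult bihom_part_const) simp
    from bihom_part_mult[OF this[simplified]] insert show ?case by simp
  qed
  from this[of "{1..n}"] show ?thesis by (simp add: xmono_def tdeg_def subset_iff)
qed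

text \<open>
  The result is homogeneous of degree \<open>d\<close> only if \<open>d\<close> is at least the degree of \<open>p\<close>, because the
  exponent of \<open>x\<^sub>0\<close> is a truncated difference.
\<close>

definition homogenize :: "nat \<Rightarrow> nat \<Rightarrow> (nat, 'k::comm_ring_1) mpoly \<Rightarrow> (var, 'k) mpoly" where
  "homogenize n d p = (\<Sum>t\<in>Poly_Mapping.keys p.
     const_poly (Poly_Mapping.lookup p t) * (var_poly (X 0) ^ (d - tdeg n t) * xmono n t))"

lemma homogenize_bihom:
  assumes "\<And>t. t \<in> Poly_Mapping.keys p \<Longrightarrow> tdeg n t \<le> d"
  shows "homogenize n d p \<in> bihom_part n m d 0"
  unfolding homogenize_def
proof (intro bihom_part_sum bihom_part_smult)
  fix t assume t: "t \<in> Poly_Mapping.keys p"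
  have "var_poly (X 0) ^ (d - tdeg n t) * xmono n t \<in> bihom_part n m (d - tdeg n t + tdeg n t) 0"
    by (intro bihom_part_X_power_mult xmono_bihom) simp
  then show "var_poly (X 0) ^ (d - tdeg n t) * xmono n t \<in> bihom_part n m d 0"
    using assms[OF t] by simp
qed

lemma mat_mult_unit_vec:
  fixes A :: "'a::comm_ring_1 mat"
  assumes "A \<in> carrier_mat k l" "j < l"
  shows "A *\<^sub>v unit_vec l j = col A j"
  using assms by (intro eq_vecI) (auto simp: scalar_prod_right_unit[of _ l])

lemma eq_mat_if_mult_vec_eq:
  fixes A :: "'a::comm_ring_1 mat"
  assumes "A \<in> carrier_mat k l" "A' \<in> carrier_mat k l"
    and "\<And>c. c \<in> carrier_vec l \<Longrightarrow> A *\<^sub>v c = A' *\<^sub>v c"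
  shows "A = A'"
proof (rule mat_col_eqI)
  fix j assume "j < dim_col A'"
  then show "col A j = col A' j"
    using assms(1,2) assms(3)[of "unit_vec l j"] by (metis carrier_matD(2) mat_mult_unit_vec unit_vec_carrier)
qed (use assms in auto)

definition relation_ideal :: "nat \<Rightarrow> nat \<Rightarrow> (nat \<Rightarrow> 'k::field mat) \<Rightarrow> (nat, 'k) mpoly set" where
  "relation_ideal n D M = {p \<in> carrier (z_ring n).
     mat_lincomb D (Poly_Mapping.lookup p) (mat_monomial n D M) (Poly_Mapping.keys p) = 0\<^sub>m D D}"

context admissible_basis
begin

abbreviation A :: "(nat \<Rightarrow>\<^sub>0 nat) \<Rightarrow> 'k mat" where
  "A t \<equiv> mat_monomial n D M t"

lemma M_pow_carrier [simp]: "M i ^\<^sub>m d \<in> carrier_mat D D"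
  by (rule pow_carrier_mat[OF M_carrier])

lemma X_power_carrier [simp]: "i \<le> n \<Longrightarrow> var_poly (X i) ^ d \<in> carrier (bi_ring n m)"
  by (induction d) simp_all

lemma M_pow_lift:
  assumes i: "i \<le> n" and c: "c \<in> carrier_vec D"
  shows "var_poly (X 0) ^ d * lift ((M i ^\<^sub>m d) *\<^sub>v c) - var_poly (X i) ^ d * lift c \<in> I"
  using c
proof (induction d arbitrary: c)
  case 0
  then show ?case by (simp add: M_carrier[THEN carrier_matD(1)])
next
  case (Suc d)
  have Mc: "M i *\<^sub>v c \<in> carrier_vec D" using Suc.prems by (rule mult_mat_vec_carrier[OF M_carrier])
  have "(M i ^\<^sub>m Suc d) *\<^sub>v c = (M i ^\<^sub>m d) *\<^sub>v (M i *\<^sub>v c)"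
    using assoc_mult_mat_vec[OF M_pow_carrier M_carrier Suc.prems] by simp
  then have "var_poly (X 0) ^ Suc d * lift ((M i ^\<^sub>m Suc d) *\<^sub>v c) - var_poly (X i) ^ Suc d * lift c =
      var_poly (X 0) * (var_poly (X 0) ^ d * lift ((M i ^\<^sub>m d) *\<^sub>v (M i *\<^sub>v c)) -
        var_poly (X i) ^ d * lift (M i *\<^sub>v c)) +
      var_poly (X i) ^ d * (var_poly (X 0) * lift (M i *\<^sub>v c) - var_poly (X i) * lift c)"
    by (simp add: algebra_simps)
  also have "\<dots> \<in> I"
    using Suc.IH[OF Mc] M_lift[OF i Suc.prems] i by (intro add ideal_mult) simp_all
  finally show ?case .
qed

lemma foldr_carrier:
  "foldr (\<lambda>i B. (M i ^\<^sub>m Poly_Mapping.lookup t i) * B) xs (1\<^sub>m D) \<in> carrier_mat D D"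
  by (induction xs) (auto intro: mult_carrier_mat[OF M_pow_carrier])

lemma A_carrier [simp]: "A t \<in> carrier_mat D D"
  unfolding mat_monomial_def by (rule foldr_carrier)

lemma A_lift:
  assumes c: "c \<in> carrier_vec D"
  shows "var_poly (X 0) ^ tdeg n t * lift (A t *\<^sub>v c) - xmono n t * lift c \<in> I"
proof -
  let ?F = "\<lambda>xs. foldr (\<lambda>i B. (M i ^\<^sub>m Poly_Mapping.lookup t i) * B) xs (1\<^sub>m D)"
  let ?x = "\<lambda>xs. (\<Prod>i\<leftarrow>xs. var_poly (X i) ^ Poly_Mapping.lookup t i) :: (var, 'k) mpoly"
  have list: "var_poly (X 0) ^ (\<Sum>i\<leftarrow>xs. Poly_Mapping.lookup t i) * lift (?F xs *\<^sub>v c) - ?x xs * lift c \<in> I"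
    if "set xs \<subseteq> {..n}" for xs
    using that
  proof (induction xs)
    case Nil
    then show ?case using c by simp
  next
    case (Cons i xs)
    let ?d = "Poly_Mapping.lookup t i" and ?s = "\<Sum>i\<leftarrow>xs. Poly_Mapping.lookup t i"
    have Fc: "?F xs *\<^sub>v c \<in> carrier_vec D" by (rule mult_mat_vec_carrier[OF foldr_carrier c])
    have i: "i \<le> n" using Cons.prems by simp
    have "?F (i # xs) *\<^sub>v c = (M i ^\<^sub>m ?d) *\<^sub>v (?F xs *\<^sub>v c)"
      using assoc_mult_mat_vec[OF M_pow_carrier foldr_carrier c] by simp
    then have "var_poly (X 0) ^ (\<Sum>i\<leftarrow>i # xs. Poly_Mapping.lookup t i) * lift (?F (i # xs) *\<^sub>v c) -
        ?x (i # xs) * lift c =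
      var_poly (X 0) ^ ?s * (var_poly (X 0) ^ ?d * lift ((M i ^\<^sub>m ?d) *\<^sub>v (?F xs *\<^sub>v c)) -
        var_poly (X i) ^ ?d * lift (?F xs *\<^sub>v c)) +
      var_poly (X i) ^ ?d * (var_poly (X 0) ^ ?s * lift (?F xs *\<^sub>v c) - ?x xs * lift c)"
      by (simp add: algebra_simps power_add)
    also have "\<dots> \<in> I"
      using M_pow_lift[OF i Fc] Cons i by (intro add ideal_mult) simp_all
    finally show ?case .
  qed
  have set_upt: "set [1..<Suc n] = {1..n}" by auto
  show ?thesis
    unfolding mat_monomial_def xmono_def tdeg_def set_upt[symmetric]
      prod.distinct_set_conv_list[OF distinct_upt] sum.distinct_set_conv_list[OF distinct_upt]
    by (rule list) auto
qed

text \<open>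
  Both sides describe multiplication by the same monomial after multiplication by a power of
  \<open>x\<^sub>0\<close>, which is injective. In particular the multiplication matrices commute.
\<close>

lemma A_add: "A (s + t) = A s * A t"
proof (rule eq_mat_if_mult_vec_eq[OF A_carrier mult_carrier_mat[OF A_carrier A_carrier]])
  fix c :: "'k vec" assume c: "c \<in> carrier_vec D"
  let ?x = "var_poly (X 0) :: (var, 'k) mpoly"
  have tc: "A t *\<^sub>v c \<in> carrier_vec D" by (rule mult_mat_vec_carrier[OF A_carrier c])
  have stc: "A s *\<^sub>v (A t *\<^sub>v c) \<in> carrier_vec D" by (rule mult_mat_vec_carrier[OF A_carrier tc])
  have s_t_c: "A (s + t) *\<^sub>v c \<in> carrier_vec D" by (rule mult_mat_vec_carrier[OF A_carrier c])
  have "?x ^ tdeg n t * (?x ^ tdeg n s * lift (A s *\<^sub>v (A t *\<^sub>v c)) - xmono n s * lift (A t *\<^sub>v c)) +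
      xmono n s * (?x ^ tdeg n t * lift (A t *\<^sub>v c) - xmono n t * lift c) \<in> I"
    using A_lift[OF tc, of s] A_lift[OF c, of t] bihom_part_carrier[OF xmono_bihom]
    by (intro add ideal_mult) simp_all
  then have "?x ^ tdeg n (s + t) * lift (A s *\<^sub>v (A t *\<^sub>v c)) - xmono n (s + t) * lift c \<in> I"
    by (simp add: xmono_add tdeg_add algebra_simps power_add)
  from diff[OF A_lift[OF c, of "s + t"] this]
  have "?x ^ tdeg n (s + t) * (lift (A (s + t) *\<^sub>v c) - lift (A s *\<^sub>v (A t *\<^sub>v c))) \<in> I"
    by (simp add: algebra_simps)
  then have "lift (A (s + t) *\<^sub>v c) - lift (A s *\<^sub>v (A t *\<^sub>v c)) \<in> I"
    by (rule x0_power_injective[OF order_refl, rotated]) simp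
  then have "A (s + t) *\<^sub>v c = A s *\<^sub>v (A t *\<^sub>v c)"
    by (rule lift_eqI[OF s_t_c stc])
  then show "A (s + t) *\<^sub>v c = (A s * A t) *\<^sub>v c"
    using assoc_mult_mat_vec[OF A_carrier A_carrier c] by simp
qed

lemma lincomb_lift:
  assumes c: "c \<in> carrier_vec D"
  shows "lift (mat_lincomb D g A S *\<^sub>v c) = (\<Sum>t\<in>S. const_poly (g t) * lift (A t *\<^sub>v c))"
proof -
  have entry: "(mat_lincomb D g A S *\<^sub>v c) $ i = (\<Sum>t\<in>S. g t * (A t *\<^sub>v c) $ i)" if "i < D" for i
  proof -
    have "(mat_lincomb D g A S *\<^sub>v c) $ i = (\<Sum>j<D. (\<Sum>t\<in>S. g t * A t $$ (i, j)) * c $ j)"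
      using that c by (simp add: mat_lincomb_def scalar_prod_def lessThan_atLeast0)
    also have "\<dots> = (\<Sum>t\<in>S. \<Sum>j<D. g t * (A t $$ (i, j) * c $ j))"
      by (subst sum.swap) (simp add: sum_distrib_right mult.assoc)
    also have "\<dots> = (\<Sum>t\<in>S. g t * (A t *\<^sub>v c) $ i)"
    proof (rule sum.cong)
      fix t assume "t \<in> S"
      have "(A t *\<^sub>v c) $ i = (\<Sum>j<D. A t $$ (i, j) * c $ j)"
        using that c carrier_matD[OF A_carrier[of t]] by (simp add: scalar_prod_def lessThan_atLeast0)
      then show "(\<Sum>j<D. g t * (A t $$ (i, j) * c $ j)) = g t * (A t *\<^sub>v c) $ i"
        by (simp add: sum_distrib_left)
    qed simp
    finally show ?thesis .
  qed
  have "lift (mat_lincomb D g A S *\<^sub>v c) = (\<Sum>i<D. \<Sum>t\<in>S. const_poly (g t * (A t *\<^sub>v c) $ i) * rep i)"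
    unfolding lift_def by (intro sum.cong) (simp_all add: entry const_poly_sum sum_distrib_right)
  also have "\<dots> = (\<Sum>t\<in>S. const_poly (g t) * lift (A t *\<^sub>v c))"
    unfolding lift_def sum_distrib_left
    by (subst sum.swap) (simp add: mult_single flip: mult.assoc)
  finally show ?thesis .
qed

text \<open>
  With \<open>P = p(M\<^sub>1, \<dots>, M\<^sub>n)\<close>, multiplying by \<open>P\<close> and then by \<open>x\<^sub>0\<^sup>d\<close> is multiplication by the
  homogenization of \<open>p\<close>. As powers of \<open>x\<^sub>0\<close> act injectively, \<open>P\<close> vanishes exactly if the
  homogenization annihilates \<open>(R/I)\<^bsub>a,b\<^esub>\<close>.
\<close>

lemma relation_ideal_iff_homogenize:
  assumes p: "p \<in> carrier (z_ring n)" and d: "\<And>t. t \<in> Poly_Mapping.keys p \<Longrightarrow> tdeg n t \<le> d"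
  shows "p \<in> relation_ideal n D M \<longleftrightarrow> (\<forall>f\<in>bihom_part n m a b. homogenize n d p * f \<in> I)"
proof -
  let ?P = "mat_lincomb D (Poly_Mapping.lookup p) A (Poly_Mapping.keys p)"
  let ?x = "var_poly (X 0) :: (var, 'k) mpoly"
  have P: "?P \<in> carrier_mat D D" by (simp add: mat_lincomb_def)
  have Pc: "?x ^ d * lift (?P *\<^sub>v c) - homogenize n d p * lift c \<in> I" if c: "c \<in> carrier_vec D" for c
  proof -
    have "?x ^ d * lift (?P *\<^sub>v c) - homogenize n d p * lift c =
        (\<Sum>t\<in>Poly_Mapping.keys p. const_poly (Poly_Mapping.lookup p t) * (?x ^ (d - tdeg n t) *
          (?x ^ tdeg n t * lift (A t *\<^sub>v c) - xmono n t * lift c)))"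
      unfolding lincomb_lift[OF c] homogenize_def sum_distrib_left sum_distrib_right sum_subtractf[symmetric]
    proof (rule sum.cong)
      fix t assume t: "t \<in> Poly_Mapping.keys p"
      then have "?x ^ d = ?x ^ (d - tdeg n t) * ?x ^ tdeg n t" using d by (simp flip: power_add)
      then show "?x ^ d * (const_poly (Poly_Mapping.lookup p t) * lift (A t *\<^sub>v c)) -
          const_poly (Poly_Mapping.lookup p t) * (?x ^ (d - tdeg n t) * xmono n t) * lift c =
          const_poly (Poly_Mapping.lookup p t) * (?x ^ (d - tdeg n t) *
          (?x ^ tdeg n t * lift (A t *\<^sub>v c) - xmono n t * lift c))"
        by (simp add: algebra_simps)
    qed simp
    also have "\<dots> \<in> I"
      using A_lift[OF c] by (intro sum ideal_mult) simp_all
    finally show ?thesis .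
  qed
  have zero: "0\<^sub>m D D *\<^sub>v c = 0\<^sub>v D" if "c \<in> carrier_vec D" for c :: "'k vec"
    using that by (intro eq_vecI) (auto simp: scalar_prod_def)
  have "p \<in> relation_ideal n D M \<longleftrightarrow> ?P = 0\<^sub>m D D" using p by (simp add: relation_ideal_def)
  also have "\<dots> \<longleftrightarrow> (\<forall>c\<in>carrier_vec D. ?P *\<^sub>v c = 0\<^sub>v D)"
    using eq_mat_if_mult_vec_eq[OF P zero_carrier_mat] zero by auto
  also have "\<dots> \<longleftrightarrow> (\<forall>c\<in>carrier_vec D. homogenize n d p * lift c \<in> I)"
  proof (rule ball_cong[OF refl])
    fix c :: "'k vec" assume c: "c \<in> carrier_vec D"
    have PcD: "?P *\<^sub>v c \<in> carrier_vec D" by (rule mult_mat_vec_carrier[OF P c])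
    show "?P *\<^sub>v c = 0\<^sub>v D \<longleftrightarrow> homogenize n d p * lift c \<in> I"
    proof
      assume "?P *\<^sub>v c = 0\<^sub>v D"
      then have "lift (?P *\<^sub>v c) = 0" by (simp add: lift_def)
      then show "homogenize n d p * lift c \<in> I" using uminus[OF Pc[OF c]] by simp
    next
      assume "homogenize n d p * lift c \<in> I"
      from add[OF Pc[OF c] this] have "?x ^ d * lift (?P *\<^sub>v c) \<in> I" by simp
      then have "lift (?P *\<^sub>v c) \<in> I"
        by (rule x0_power_injective[OF order_refl lift_bihom])
      then show "?P *\<^sub>v c = 0\<^sub>v D" by (rule lift_injective[OF PcD])
    qed
  qed
  also have "\<dots> \<longleftrightarrow> (\<forall>f\<in>bihom_part n m a b. homogenize n d p * f \<in> I)"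
  proof
    assume l: "\<forall>c\<in>carrier_vec D. homogenize n d p * lift c \<in> I"
    show "\<forall>f\<in>bihom_part n m a b. homogenize n d p * f \<in> I"
    proof
      fix f :: "(var, 'k) mpoly" assume "f \<in> bihom_part n m a b"
      then obtain c where c: "c \<in> carrier_vec D" "f - lift c \<in> I" by (rule lift_surjective)
      have "homogenize n d p * (f - lift c) \<in> I"
        by (rule ideal_mult[OF c(2) bihom_part_carrier[OF homogenize_bihom[OF d]]])
      from add[OF this bspec[OF l c(1)]] show "homogenize n d p * f \<in> I"
        by (simp add: algebra_simps)
    qed
  qed simp
  finally show ?thesis .
qed

end

section \<open>The dehomogenization of \<open>J\<^sub>b\<close>\<close>

lemma Fract_sum:
  fixes q :: "'r::idom"
  assumes "q \<noteq> 0"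
  shows "(\<Sum>i\<in>S. Fract (f i) q) = Fract (\<Sum>i\<in>S. f i) q"
proof (induction S rule: infinite_finite_induct)
  case (insert i S)
  then show ?case using assms by (simp add: eq_fract algebra_simps)
qed (use assms in \<open>auto simp: Zero_fract_def eq_fract\<close>)

lemma Fract_power: "Fract p q ^ d = Fract (p ^ d) (q ^ d)"
  by (induction d) (simp_all add: One_fract_def)

lemma Fract_prod: "(\<Prod>i\<in>S. Fract (f i) (g i)) = Fract (\<Prod>i\<in>S. f i) (\<Prod>i\<in>S. g i)"
  by (induction S rule: infinite_finite_induct) (simp_all add: One_fract_def)

abbreviation x0_power :: "nat \<Rightarrow> (var, 'k::field) mpoly" where
  "x0_power d \<equiv> var_poly (X 0) ^ d"

lemma localization_cring: "cring (x0_localization n :: (var, 'k::field) mpoly fract ring)"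
  unfolding x0_localization_def
proof (rule subring_cring)
  let ?C = "{Fract f (x0_power d) | f d. f \<in> carrier (x_ring n)} :: (var, 'k) mpoly fract set"
  have C: "Fract f (x0_power d) \<in> ?C" if "f \<in> carrier (x_ring n)" for f d using that by blast
  show "0 \<in> ?C" "1 \<in> ?C"
    using C[of 0 0] C[of 1 0] by (simp_all add: x_ring_def Zero_fract_def One_fract_def)
  fix x y :: "(var, 'k) mpoly fract"
  assume "x \<in> ?C"
  then obtain f d where x: "x = Fract f (x0_power d)" "f \<in> carrier (x_ring n)" by blast
  then show "- x \<in> ?C" using C[of "- f" d] by (simp add: x_ring_def)
  assume "y \<in> ?C"
  then obtain g e where y: "y = Fract g (x0_power e)" "g \<in> carrier (x_ring n)" by blast
  have "f * x0_power e + g * x0_power d \<in> carrier (x_ring n)" "f * g \<in> carrier (x_ring n)"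
    using x(2) y(2) by (simp_all add: x_ring_def)
  from C[OF this(1), of "d + e"] C[OF this(2), of "d + e"]
  show "x + y \<in> ?C" "x * y \<in> ?C" by (simp_all add: x(1) y(1) power_add)
qed

text \<open>
  Finitely many fractions have a common denominator, so the fractions with numerator in \<open>J\<close>
  already form an ideal.
\<close>

lemma extended_ideal_eq:
  fixes J :: "(var, 'k::field) mpoly set"
  assumes J: "ideal J (x_ring n)"
  shows "genideal (x0_localization n) ((\<lambda>f. Fract f 1) ` J) = {Fract f (x0_power d) | f d. f \<in> J}"
    (is "_ = ?E")
proof
  interpret J: poly_ideal "X ` {..n}" J using J by (simp add: poly_ideal_def x_ring_def)
  interpret L: cring "x0_localization n :: (var, 'k) mpoly fract ring" by (rule localization_cring)
  have L: "Fract f (x0_power d) \<in> carrier (x0_localization n)" if "f \<in> carrier (x_ring n)"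
    for f :: "(var, 'k) mpoly" and d
    using that by (auto simp: x0_localization_def)
  have JR: "f \<in> carrier (x_ring n)" if "f \<in> J" for f using J.in_carrier[OF that] by (simp add: x_ring_def)
  have x0J: "f * x0_power d \<in> J" if "f \<in> J" for f d using that by simp
  have E: "Fract f (x0_power d) \<in> ?E" if "f \<in> J" for f d using that by blast
  have ideal_E: "ideal ?E (x0_localization n)"
    unfolding x0_localization_def
  proof (rule subring_idealI)
    let ?C = "{Fract f (x0_power d) | f d. f \<in> carrier (x_ring n)} :: (var, 'k) mpoly fract set"
    show "cring \<lparr>carrier = ?C, mult = (*), one = 1, zero = 0, add = (+)\<rparr>"
      using localization_cring[of n] by (simp add: x0_localization_def)
    show "- 1 \<in> ?C"
      by (rule CollectI, rule exI[of _ "- 1"], rule exI[of _ 0]) (simp add: x_ring_def One_fract_def)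
    show "?E \<subseteq> ?C" using JR by blast
    show "0 \<in> ?E" using E[OF J.zero, of 0] by (simp add: Zero_fract_def)
    fix x y assume "x \<in> ?E"
    then obtain f d where x: "x = Fract f (x0_power d)" "f \<in> J" by blast
    {
      assume "y \<in> ?E"
      then obtain g e where y: "y = Fract g (x0_power e)" "g \<in> J" by blast
      have "f * x0_power e + g * x0_power d \<in> J" using x(2) y(2) by simp
      from E[OF this, of "d + e"] show "x + y \<in> ?E" by (simp add: x(1) y(1) power_add)
    }
    assume "y \<in> ?C"
    then obtain g e where y: "y = Fract g (x0_power e)" "g \<in> carrier (x_ring n)" by blast
    have "g * f \<in> J" using x(2) y(2) by (simp add: x_ring_def)
    from E[OF this, of "e + d"] show "y * x \<in> ?E" by (simp add: x(1) y(1) power_add)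
  qed
  have gens: "(\<lambda>f. Fract f 1) ` J \<subseteq> ?E" using E[of _ 0] by auto
  show "genideal (x0_localization n) ((\<lambda>f. Fract f 1) ` J) \<subseteq> ?E"
    by (rule L.genideal_minimal[OF ideal_E gens])
  have JL: "(\<lambda>f. Fract f 1) ` J \<subseteq> carrier (x0_localization n)" using L[OF JR, of _ 0] by auto
  interpret G: ideal "genideal (x0_localization n) ((\<lambda>f. Fract f 1) ` J)" "x0_localization n"
    by (rule L.genideal_ideal[OF JL])
  show "?E \<subseteq> genideal (x0_localization n) ((\<lambda>f. Fract f 1) ` J)"
  proof
    fix x assume "x \<in> ?E"
    then obtain f d where x: "x = Fract f (x0_power d)" "f \<in> J" by blast
    have "Fract f 1 \<in> genideal (x0_localization n) ((\<lambda>f. Fract f 1) ` J)"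
      using L.genideal_self[OF JL] x(2) by blast
    from G.I_r_closed[OF this L[of 1 d]] show "x \<in> genideal (x0_localization n) ((\<lambda>f. Fract f 1) ` J)"
      by (simp add: x(1) x0_localization_def x_ring_def)
  qed
qed

lemma z_eval_eq:
  fixes p :: "(nat, 'k::field) mpoly"
  assumes p: "p \<in> carrier (z_ring n)" and d: "\<And>t. t \<in> Poly_Mapping.keys p \<Longrightarrow> tdeg n t \<le> d"
  shows "z_eval p = Fract (homogenize n d p) (x0_power d)"
proof -
  let ?x = "\<lambda>i. Fract (var_poly (X i)) (var_poly (X 0)) :: (var, 'k) mpoly fract"
  have mono: "Fract (const_poly (Poly_Mapping.lookup p t)) 1 *
      (\<Prod>i\<in>Poly_Mapping.keys t. ?x i ^ Poly_Mapping.lookup t i) =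
      Fract (const_poly (Poly_Mapping.lookup p t) * (x0_power (d - tdeg n t) * xmono n t)) (x0_power d)"
    if t: "t \<in> Poly_Mapping.keys p" for t
  proof -
    have "Poly_Mapping.keys t \<subseteq> {1..n}" using p t by (simp add: z_ring_def poly_ring_carrier)
    then have "(\<Prod>i\<in>Poly_Mapping.keys t. ?x i ^ Poly_Mapping.lookup t i) =
        (\<Prod>i=1..n. ?x i ^ Poly_Mapping.lookup t i)"
      by (intro prod.mono_neutral_left) (auto simp: in_keys_iff)
    also have "\<dots> = Fract (xmono n t) (x0_power (tdeg n t))"
      by (simp add: Fract_power Fract_prod xmono_def tdeg_def power_sum)
    finally have "Fract (const_poly (Poly_Mapping.lookup p t)) 1 *
        (\<Prod>i\<in>Poly_Mapping.keys t. ?x i ^ Poly_Mapping.lookup t i) =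
        Fract (const_poly (Poly_Mapping.lookup p t) * xmono n t) (x0_power (tdeg n t))" by simp
    also have "\<dots> = Fract (const_poly (Poly_Mapping.lookup p t) * (x0_power (d - tdeg n t) * xmono n t)) (x0_power d)"
    proof -
      have "x0_power d = x0_power (d - tdeg n t) * (x0_power (tdeg n t) :: (var, 'k) mpoly)"
        using d[OF t] by (simp flip: power_add)
      then show ?thesis by (simp add: eq_fract algebra_simps)
    qed
    finally show ?thesis .
  qed
  show ?thesis
    unfolding z_eval_def homogenize_def
    by (subst Fract_sum[symmetric]) (auto intro!: sum.cong mono)
qed

lemma deg0_localization_mem:
  fixes p :: "(nat, 'k::field) mpoly"
  assumes d: "\<And>t. t \<in> Poly_Mapping.keys p \<Longrightarrow> tdeg n t \<le> d"
  shows "homogenize n d p \<in> carrier (x_ring n)"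
    and "Fract (homogenize n d p) (x0_power d) \<in> x0_localization_deg0 n"
proof -
  have "xmono n t \<in> carrier (x_ring n)" for t
    unfolding xmono_def x_ring_def by (intro poly_ring_prod poly_ring_power poly_ring_single) auto
  then show h: "homogenize n d p \<in> carrier (x_ring n)"
    unfolding homogenize_def x_ring_def by (intro poly_ring_sum poly_ring_mult) simp_all
  have hom: "homogenize n d p \<in> bihom_part n 0 d 0" by (rule homogenize_bihom[OF d])
  have "\<forall>t\<in>Poly_Mapping.keys (homogenize n d p). xdeg t = d"
    using hom by (simp add: bihom_part_iff)
  with h show "Fract (homogenize n d p) (x0_power d) \<in> x0_localization_deg0 n"
    unfolding x0_localization_deg0_def by blast
qed

text \<open>This turns membership in \<open>J\<^sub>b\<close> into a condition on single terms.\<close>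

lemma y_ideal_power:
  "ideal_power (bi_ring n m) (y_ideal n m) b =
    {g \<in> carrier (bi_ring n m :: (var, 'k::field) mpoly ring). \<forall>t\<in>Poly_Mapping.keys g. b \<le> ydeg t}"
proof (induction b)
  case 0
  show ?case by (simp add: ideal_power_def)
next
  case (Suc b)
  let ?V = "X ` {..n} \<union> Y ` {..m}"
  let ?Y = "y_ideal n m :: (var, 'k) mpoly set"
  let ?K = "\<lambda>b. {g \<in> carrier (bi_ring n m :: (var, 'k) mpoly ring). \<forall>t\<in>Poly_Mapping.keys g. b \<le> ydeg t}"
  have gens: "(\<lambda>j. var_poly (Y j)) ` {..m} \<subseteq> carrier (poly_ring ?V :: (var, 'k) mpoly ring)"
    by (auto simp: image_subset_iff)
  interpret Y: poly_ideal ?V ?Y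
    unfolding y_ideal_def bi_ring_def poly_ideal_def by (rule poly_ring.genideal_ideal[OF gens])
  have Y1: "1 \<le> ydeg t" if g: "g \<in> ?Y" and t: "t \<in> Poly_Mapping.keys g" for g t
  proof -
    have "\<forall>t\<in>Poly_Mapping.keys g. 1 \<le> ydeg t"
      using g[unfolded y_ideal_def bi_ring_def] gens
    proof (induction g rule: genideal_poly_induct)
      case (add g h)
      then show ?case using keys_add[of g h] by blast
    next
      case (gen t c g)
      then obtain j where "g = var_poly (Y j)" by blast
      then show ?case by (simp add: mult_single)
    qed simp
    with t show ?thesis by blast
  qed
  have pow: "ideal_power (bi_ring n m) ?Y (Suc b) = ideal_prod (bi_ring n m) ?Y (?K b)"
    using Suc.IH by (simp add: ideal_power_def)
  show ?case
    unfolding pow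
  proof
    show "ideal_prod (bi_ring n m) ?Y (?K b) \<subseteq> ?K (Suc b)"
    proof
      fix g assume "g \<in> ideal_prod (bi_ring n m) ?Y (?K b)"
      then show "g \<in> ?K (Suc b)"
      proof (induction g)
        case (prod g h)
        have "Suc b \<le> ydeg t" if "t \<in> Poly_Mapping.keys (g * h)" for t
        proof -
          obtain u v where "u \<in> Poly_Mapping.keys g" "v \<in> Poly_Mapping.keys h" "t = u + v"
            using subsetD[OF keys_mult \<open>t \<in> Poly_Mapping.keys (g * h)\<close>] by blast
          then show ?thesis using Y1[OF prod(1), of u] prod(2) by fastforce
        qed
        moreover have "g * h \<in> carrier (bi_ring n m)"
          using Y.in_carrier[OF prod(1)] prod(2) by (simp add: bi_ring_def)
        ultimately show ?case by simp
      next
        case (sum g h)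
        then show ?case using keys_add[of g h] by (auto simp: bi_ring_def)
      qed
    qed
    show "?K (Suc b) \<subseteq> ideal_prod (bi_ring n m) ?Y (?K b)"
    proof
      fix g assume g: "g \<in> ?K (Suc b)"
      show "g \<in> ideal_prod (bi_ring n m) ?Y (?K b)"
      proof (rule poly_additive_induct[where f = g])
        have "0 \<in> ?K b" by (simp add: bi_ring_def)
        from ideal_prod.prod[OF Y.zero this, of "bi_ring n m"] show "0 \<in> ideal_prod (bi_ring n m) ?Y (?K b)" by simp
      next
        fix g h assume "g \<in> ideal_prod (bi_ring n m) ?Y (?K b)" "h \<in> ideal_prod (bi_ring n m) ?Y (?K b)"
        from ideal_prod.sum[OF this] show "g + h \<in> ideal_prod (bi_ring n m) ?Y (?K b)" by simp
      next
        fix t assume t: "t \<in> Poly_Mapping.keys g"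
        then have tV: "Poly_Mapping.keys t \<subseteq> ?V" and "ydeg t > 0" and deg: "Suc b \<le> ydeg t"
          using g by (auto simp: bi_ring_def poly_ring_carrier)
        then obtain j t' where j: "Y j \<in> Poly_Mapping.keys t" "t = Poly_Mapping.single (Y j) 1 + t'"
          using ydeg_pos_split by blast
        have "var_poly (Y j) \<in> ?Y"
          using poly_ring.genideal_self[OF gens] j(1) tV by (auto simp: y_ideal_def bi_ring_def)
        moreover have "Poly_Mapping.single t' (Poly_Mapping.lookup g t) \<in> ?K b"
          using tV deg j(2) by (auto simp: bi_ring_def keys_add_exponents)
        ultimately have "var_poly (Y j) * Poly_Mapping.single t' (Poly_Mapping.lookup g t) \<in>
            ideal_prod (bi_ring n m) ?Y (?K b)"
          using ideal_prod.prod[of "var_poly (Y j)" ?Y _ "?K b" "bi_ring n m"] by simp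
        then show "Poly_Mapping.single t (Poly_Mapping.lookup g t) \<in> ideal_prod (bi_ring n m) ?Y (?K b)"
          using single_X_add[of "Y j" t' "Poly_Mapping.lookup g t"] by (simp flip: j(2))
      qed
    qed
  qed
qed

lemma monomial_split_ydeg:
  assumes "b \<le> ydeg t"
  obtains s u where "t = s + u" "xdeg s = 0" "ydeg s = b"
proof -
  have "\<exists>s u. t = s + u \<and> xdeg s = 0 \<and> ydeg s = b"
    using assms
  proof (induction b)
    case 0
    show ?case by (intro exI[of _ 0] exI[of _ t]) simp
  next
    case (Suc b)
    then obtain s u where su: "t = s + u" "xdeg s = 0" "ydeg s = b" by auto
    with Suc.prems have "ydeg u > 0" by simp
    then obtain j u' where "u = Poly_Mapping.single (Y j) 1 + u'" by (rule ydeg_pos_split)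
    with su show ?case
      by (intro exI[of _ "s + Poly_Mapping.single (Y j) 1"] exI[of _ u']) (simp add: add.assoc)
  qed
  then show thesis using that by blast
qed

context bi_ideal
begin

lemma J_ideal_iff:
  "f \<in> J_ideal n m I b \<longleftrightarrow> f \<in> carrier (x_ring n) \<and>
    (\<forall>g\<in>carrier (bi_ring n m). (\<forall>t\<in>Poly_Mapping.keys g. b \<le> ydeg t) \<longrightarrow> f * g \<in> I)"
proof -
  have "f \<in> carrier (bi_ring n m)" if "f \<in> carrier (x_ring n)"
    using that by (auto simp: x_ring_def bi_ring_def poly_ring_carrier)
  then show ?thesis
    by (auto simp: J_ideal_def ideal_colon_def y_ideal_power)
qed

lemma J_ideal_ideal: "ideal (J_ideal n m I b) (x_ring n)"
  unfolding x_ring_def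
proof (rule poly_ring_idealI)
  fix f r :: "(var, 'k) mpoly"
  assume f: "f \<in> J_ideal n m I b" and r: "r \<in> carrier (poly_ring (X ` {..n}))"
  have rb: "r \<in> carrier (bi_ring n m)"
    using r by (auto simp: bi_ring_def poly_ring_carrier)
  have "r * f \<in> carrier (x_ring n)"
    using f r by (simp add: J_ideal_iff x_ring_def)
  moreover have "r * f * g \<in> I"
    if "g \<in> carrier (bi_ring n m)" "\<forall>t\<in>Poly_Mapping.keys g. b \<le> ydeg t" for g
    using f that ideal_mult[OF _ rb, of "f * g"] by (simp add: J_ideal_iff mult.assoc)
  ultimately show "r * f \<in> J_ideal n m I b" by (simp add: J_ideal_iff)
qed (auto simp: J_ideal_iff x_ring_def distrib_right)

text \<open>Every term of \<open>y\<close>-degree at least \<open>b\<close> is a multiple of a term of bidegree \<open>(0, b)\<close>.\<close>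

lemma J_idealI:
  assumes f: "f \<in> carrier (x_ring n)" and bihom: "\<And>g. g \<in> bihom_part n m 0 b \<Longrightarrow> f * g \<in> I"
  shows "f \<in> J_ideal n m I b"
proof -
  have "f * g \<in> I" if g: "g \<in> carrier (bi_ring n m)" "\<forall>t\<in>Poly_Mapping.keys g. b \<le> ydeg t" for g
  proof (rule poly_additive_induct[where f = g])
    fix t assume t: "t \<in> Poly_Mapping.keys g"
    let ?c = "Poly_Mapping.lookup g t"
    obtain s u where su: "t = s + u" "xdeg s = 0" "ydeg s = b"
      using monomial_split_ydeg g(2) t by blast
    have "Poly_Mapping.keys t \<subseteq> X ` {..n} \<union> Y ` {..m}"
      using g(1) t by (simp add: bi_ring_def poly_ring_carrier)
    then have "Poly_Mapping.keys s \<subseteq> X ` {..n} \<union> Y ` {..m}" "Poly_Mapping.keys u \<subseteq> X ` {..n} \<union> Y ` {..m}"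
      by (simp_all add: su(1) keys_add_exponents)
    then have "f * monom_poly s \<in> I" "Poly_Mapping.single u ?c \<in> carrier (bi_ring n m)"
      using bihom su by (simp_all add: bi_ring_def)
    then have "Poly_Mapping.single u ?c * (f * monom_poly s) \<in> I" by (rule ideal_mult)
    moreover have "Poly_Mapping.single u ?c * (f * monom_poly s) = f * Poly_Mapping.single t ?c"
      by (simp add: su(1) mult_single mult.left_commute add.commute)
    ultimately show "f * Poly_Mapping.single t ?c \<in> I" by simp
  qed (simp_all add: distrib_left)
  with f show ?thesis by (simp add: J_ideal_iff)
qed

end

context admissible_basis
begin

text \<open>
  Both sides consist of the \<open>p\<close> whose homogenization annihilates \<open>(R/I)\<^bsub>a,b\<^esub>\<close>. An element of \<open>J\<^sub>b\<close>
  annihilates \<open>(R/I)\<^bsub>0,b\<^esub>\<close>, hence also \<open>(R/I)\<^bsub>a,b\<^esub>\<close>; conversely, a polynomial that annihilates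
  \<open>(R/I)\<^bsub>a,b\<^esub>\<close> lies in \<open>J\<^sub>b\<close> after multiplication by \<open>x\<^sub>0\<^sup>a\<close>, a unit of the localization.
\<close>

lemma relation_ideal_eq_affine_ideal: "relation_ideal n D M = affine_ideal n m I b"
proof -
  have "p \<in> relation_ideal n D M \<longleftrightarrow> p \<in> affine_ideal n m I b" if p: "p \<in> carrier (z_ring n)" for p
  proof -
    define d where "d = Max (insert 0 (tdeg n ` Poly_Mapping.keys p))"
    have d: "tdeg n t \<le> d" if "t \<in> Poly_Mapping.keys p" for t
      using that by (simp add: d_def)
    let ?h = "homogenize n d p"
    have h: "?h \<in> bihom_part n m d 0" by (rule homogenize_bihom[OF d])
    have hX: "?h \<in> carrier (x_ring n)" by (rule deg0_localization_mem(1)[OF d])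
    have h0: "Fract ?h (x0_power d) \<in> x0_localization_deg0 n" by (rule deg0_localization_mem(2)[OF d])
    have eval: "z_eval p = Fract ?h (x0_power d)" by (rule z_eval_eq[OF p d])
    have "p \<in> affine_ideal n m I b \<longleftrightarrow>
        (\<exists>f e. Fract ?h (x0_power d) = Fract f (x0_power e) \<and> f \<in> J_ideal n m I b)"
      using p h0 by (auto simp: affine_ideal_def extended_ideal_eq[OF J_ideal_ideal] eval)
    also have "\<dots> \<longleftrightarrow> (\<forall>f\<in>bihom_part n m a b. ?h * f \<in> I)"
    proof
      assume "\<exists>f e. Fract ?h (x0_power d) = Fract f (x0_power e) \<and> f \<in> J_ideal n m I b"
      then obtain f e where f: "f \<in> J_ideal n m I b" and eq: "?h * x0_power e = f * x0_power d"
        by (auto simp: eq_fract)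
      show "\<forall>g\<in>bihom_part n m a b. ?h * g \<in> I"
      proof
        fix g :: "(var, 'k) mpoly" assume g: "g \<in> bihom_part n m a b"
        then have "f * g \<in> I"
          using f bihom_part_carrier[OF g] by (simp add: J_ideal_iff bihom_part_iff)
        then have "x0_power d * (f * g) \<in> I" by (rule ideal_mult) simp
        also have "x0_power d * (f * g) = (f * x0_power d) * g" by (simp only: ac_simps)
        also have "\<dots> = x0_power e * (?h * g)" by (simp only: eq[symmetric] ac_simps)
        finally have xhg: "x0_power e * (?h * g) \<in> I" .
        have "?h * g \<in> bihom_part n m (d + a) b"
          using bihom_part_mult[OF h g] by simp
        from x0_power_injective[OF le_add2 this xhg] show "?h * g \<in> I" .
      qed
    next
      assume ann: "\<forall>f\<in>bihom_part n m a b. ?h * f \<in> I"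
      have "?h * x0_power a \<in> J_ideal n m I b"
      proof (rule J_idealI)
        show "?h * x0_power a \<in> carrier (x_ring n)"
          using hX by (simp add: x_ring_def)
        fix g :: "(var, 'k) mpoly" assume "g \<in> bihom_part n m 0 b"
        then have "x0_power a * g \<in> bihom_part n m a b"
          using bihom_part_X_power_mult[of 0 n g m 0 b a] by simp
        with ann show "?h * x0_power a * g \<in> I" by (simp add: mult.assoc)
      qed
      moreover have "Fract ?h (x0_power d) = Fract (?h * x0_power a) (x0_power (d + a))"
        by (simp add: eq_fract power_add)
      ultimately show "\<exists>f e. Fract ?h (x0_power d) = Fract f (x0_power e) \<and> f \<in> J_ideal n m I b"
        by blast
    qed
    also have "\<dots> \<longleftrightarrow> p \<in> relation_ideal n D M"
      by (rule relation_ideal_iff_homogenize[OF p d, symmetric])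
    finally show ?thesis ..
  qed
  then show ?thesis by (auto simp: relation_ideal_def affine_ideal_def)
qed

end

section \<open>Monomial orders\<close>

locale mono_order =
  fixes n :: nat and r :: "(nat \<Rightarrow>\<^sub>0 nat) rel"
  assumes order: "monomial_order n r"
begin

abbreviation Z :: "(nat \<Rightarrow>\<^sub>0 nat) set" where "Z \<equiv> z_monomials n"

lemma z_zero [simp]: "0 \<in> Z"
  by (simp add: z_monomials_def)

lemma z_add_iff [simp]: "s + t \<in> Z \<longleftrightarrow> s \<in> Z \<and> t \<in> Z"
  by (auto simp: z_monomials_def keys_add_exponents)

lemma z_single [simp]: "i \<in> {1..n} \<Longrightarrow> Poly_Mapping.single i d \<in> Z"
  by (simp add: z_monomials_def)

lemma well_order: "well_order_on Z r"
  using order by (simp add: monomial_order_def)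

lemma le_refl: "s \<in> Z \<Longrightarrow> (s, s) \<in> r"
  using well_order by (auto simp: order_on_defs refl_on_def)

lemma le_in: "(s, t) \<in> r \<Longrightarrow> s \<in> Z \<and> t \<in> Z"
  using well_order by (auto simp: order_on_defs refl_on_def)

lemma le_trans: "(s, t) \<in> r \<Longrightarrow> (t, u) \<in> r \<Longrightarrow> (s, u) \<in> r"
  using well_order by (auto simp: order_on_defs dest: transD)

lemma le_antisym: "(s, t) \<in> r \<Longrightarrow> (t, s) \<in> r \<Longrightarrow> s = t"
  using well_order by (auto simp: order_on_defs dest: antisymD)

lemma le_total: "s \<in> Z \<Longrightarrow> t \<in> Z \<Longrightarrow> (s, t) \<in> r \<or> (t, s) \<in> r"
  using well_order le_refl by (cases "s = t") (auto simp: order_on_defs total_on_def)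

lemma le_add: "(s, t) \<in> r \<Longrightarrow> u \<in> Z \<Longrightarrow> (s + u, t + u) \<in> r"
  using order by (auto simp: monomial_order_def)

lemma wf_less: "wf (r - Id)"
  using well_order by (simp add: well_order_on_def)

lemma least_exists:
  assumes "L \<subseteq> Z" "L \<noteq> {}"
  shows "\<exists>!u. u \<in> L \<and> (\<forall>v\<in>L. (u, v) \<in> r)"
proof -
  obtain u where u: "u \<in> L" "\<And>v. (v, u) \<in> r - Id \<Longrightarrow> v \<notin> L"
    using wf_less assms(2) by (metis all_not_in_conv wf_eq_minimal)
  have "(u, v) \<in> r" if "v \<in> L" for v
    using u le_total[of u v] le_refl[of u] assms(1) that by blast
  with u(1) show ?thesis using le_antisym by blast
qed

lemma greatest_exists:
  assumes "finite T" "T \<noteq> {}" "T \<subseteq> Z"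
  shows "\<exists>u\<in>T. \<forall>v\<in>T. (v, u) \<in> r"
  using assms
proof (induction T rule: finite_ne_induct)
  case (singleton x)
  then show ?case using le_refl by simp
next
  case (insert x T)
  then obtain u where u: "u \<in> T" "\<forall>v\<in>T. (v, u) \<in> r" by auto
  show ?case
  proof (cases "(x, u) \<in> r")
    case True
    with u show ?thesis by auto
  next
    case False
    then have "(u, x) \<in> r" using le_total insert.prems u(1) by blast
    with u le_trans le_refl insert.prems show ?thesis by (metis insert_iff subsetD)
  qed
qed

text \<open>If \<open>t < 1\<close> then \<open>1 > t > t\<^sup>2 > \<dots>\<close> descends forever.\<close>

lemma zero_le:
  assumes "t \<in> Z"
  shows "(0, t) \<in> r"
proof (rule ccontr)
  assume neg: "(0, t) \<notin> r"
  then have t0: "(t, 0) \<in> r" using le_total[of 0 t] assms by auto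
  define P where "P = range (\<lambda>k. ((+) t ^^ k) 0)"
  have P: "((+) t ^^ k) 0 \<in> Z" for k using assms by (induction k) auto
  then have "P \<subseteq> Z" "P \<noteq> {}" by (auto simp: P_def)
  from least_exists[OF this] obtain u where u: "u \<in> P" "\<And>v. v \<in> P \<Longrightarrow> (u, v) \<in> r" by blast
  from u(1) obtain k where k: "u = ((+) t ^^ k) 0" by (auto simp: P_def)
  then have "t + u \<in> P" using rangeI[of "\<lambda>k. ((+) t ^^ k) 0" "Suc k"] by (simp add: P_def)
  then have "(u, t + u) \<in> r" by (rule u(2))
  moreover have "(t + u, u) \<in> r" using le_add[OF t0, of u] k P by simp
  ultimately have "t + u = u" by (rule le_antisym[rotated])
  then have "t = 0" by simp
  with neg le_refl show False by simp
qed

lemma le_add_right: "s \<in> Z \<Longrightarrow> t \<in> Z \<Longrightarrow> (s, s + t) \<in> r"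
  using le_add[OF zero_le, of t s] by (simp add: add.commute)

lemma lead_monomialI:
  assumes "u \<in> Poly_Mapping.keys p" "\<And>s. s \<in> Poly_Mapping.keys p \<Longrightarrow> (s, u) \<in> r"
  shows "lead_monomial r p = u"
  unfolding lead_monomial_def using assms le_antisym by (intro the_equality) blast+

lemma lead_monomial:
  assumes "p \<noteq> 0" "Poly_Mapping.keys p \<subseteq> Z"
  shows "lead_monomial r p \<in> Poly_Mapping.keys p"
    and "\<And>s. s \<in> Poly_Mapping.keys p \<Longrightarrow> (s, lead_monomial r p) \<in> r"
proof -
  have "Poly_Mapping.keys p \<noteq> {}"
    using assms(1) poly_mapping_eqI[of p 0] by (auto simp: in_keys_iff)
  then obtain u where u: "u \<in> Poly_Mapping.keys p" "\<And>s. s \<in> Poly_Mapping.keys p \<Longrightarrow> (s, u) \<in> r"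
    using greatest_exists[of "Poly_Mapping.keys p"] assms(2) by auto
  then show "lead_monomial r p \<in> Poly_Mapping.keys p"
    and "\<And>s. s \<in> Poly_Mapping.keys p \<Longrightarrow> (s, lead_monomial r p) \<in> r"
    by (simp_all add: lead_monomialI[OF u])
qed

end

section \<open>The FGLM algorithm\<close>

interpretation entries: vector_space "\<lambda>(c :: 'k::field) f (x :: 'i). c * f x"
  by unfold_locales (auto simp: fun_eq_iff algebra_simps)

lemma sum_fun_apply: "(\<Sum>i\<in>A. g i) x = (\<Sum>i\<in>A. g i x)"
  by (induction A rule: infinite_finite_induct) auto

lemma in_span_of_indicators:
  fixes f :: "'i \<Rightarrow> 'k::field"
  assumes "finite Q" "\<And>x. x \<notin> Q \<Longrightarrow> f x = 0"
  shows "f \<in> entries.span ((\<lambda>q x. if x = q then 1 else 0) ` Q)"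
proof -
  have "f = (\<Sum>q\<in>Q. (\<lambda>x. f q * (if x = q then 1 else 0)))"
    using assms by (auto simp: fun_eq_iff sum_fun_apply if_distrib sum.delta' cong: if_cong)
  also have "\<dots> \<in> entries.span ((\<lambda>q x. if x = q then 1 else 0) ` Q)"
    by (intro entries.span_sum entries.span_scale entries.span_base) auto
  finally show ?thesis .
qed

definition mat_entries :: "nat \<Rightarrow> 'k::field mat \<Rightarrow> nat \<times> nat \<Rightarrow> 'k" where
  "mat_entries D A = (\<lambda>(p, q). if p < D \<and> q < D then A $$ (p, q) else 0)"

lemma mat_eq_lincomb_iff:
  assumes "A \<in> carrier_mat D D"
  shows "A = mat_lincomb D c F S \<longleftrightarrow>
    mat_entries D A = (\<Sum>v\<in>S. (\<lambda>x. c v * mat_entries D (F v) x))"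
proof
  assume "A = mat_lincomb D c F S"
  then show "mat_entries D A = (\<Sum>v\<in>S. (\<lambda>x. c v * mat_entries D (F v) x))"
    by (auto simp: fun_eq_iff sum_fun_apply mat_entries_def mat_lincomb_def)
next
  assume eq: "mat_entries D A = (\<Sum>v\<in>S. (\<lambda>x. c v * mat_entries D (F v) x))"
  have "A $$ (p, q) = (\<Sum>v\<in>S. c v * F v $$ (p, q))" if "p < D" "q < D" for p q
    using fun_cong[OF eq, of "(p, q)"] that by (simp add: sum_fun_apply mat_entries_def)
  then show "A = mat_lincomb D c F S"
    using assms by (intro eq_matI) (auto simp: mat_lincomb_def)
qed

locale fglm_input = mono_order n r
  for n :: nat and r :: "(nat \<Rightarrow>\<^sub>0 nat) rel" +
  fixes D :: nat and M :: "nat \<Rightarrow> 'k::field mat"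
  assumes carrier: "t \<in> Z \<Longrightarrow> mat_monomial n D M t \<in> carrier_mat D D"
    and multiplicative: "s \<in> Z \<Longrightarrow> t \<in> Z \<Longrightarrow>
      mat_monomial n D M (s + t) = mat_monomial n D M s * mat_monomial n D M t"
begin

abbreviation E :: "(nat \<Rightarrow>\<^sub>0 nat) \<Rightarrow> nat \<times> nat \<Rightarrow> 'k" where
  "E t \<equiv> mat_entries D (mat_monomial n D M t)"

abbreviation combination :: "((nat \<Rightarrow>\<^sub>0 nat) \<Rightarrow> 'k) \<Rightarrow> (nat \<Rightarrow>\<^sub>0 nat) set \<Rightarrow> nat \<times> nat \<Rightarrow> 'k" where
  "combination c S \<equiv> (\<Sum>v\<in>S. (\<lambda>x. c v * E v x))"

lemma relation_iff:
  "u \<in> Z \<Longrightarrow> mat_monomial n D M u = mat_lincomb D c (mat_monomial n D M) S \<longleftrightarrow> E u = combination c S"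
  by (rule mat_eq_lincomb_iff[OF carrier])

lemma relation_ideal_iff:
  "p \<in> relation_ideal n D M \<longleftrightarrow> Poly_Mapping.keys p \<subseteq> Z \<and>
     combination (Poly_Mapping.lookup p) (Poly_Mapping.keys p) = 0"
proof -
  have zero: "mat_entries D (0\<^sub>m D D :: 'k mat) = 0"
    by (auto simp: mat_entries_def fun_eq_iff)
  have "p \<in> carrier (z_ring n) \<longleftrightarrow> Poly_Mapping.keys p \<subseteq> Z"
    by (auto simp: z_ring_def poly_ring_carrier z_monomials_def)
  moreover have "mat_lincomb D (Poly_Mapping.lookup p) (mat_monomial n D M) (Poly_Mapping.keys p) = 0\<^sub>m D D
      \<longleftrightarrow> combination (Poly_Mapping.lookup p) (Poly_Mapping.keys p) = 0"
    unfolding eq_commute[of _ "0\<^sub>m D D"] eq_commute[of _ 0]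
      mat_eq_lincomb_iff[OF zero_carrier_mat] zero ..
  ultimately show ?thesis by (simp add: relation_ideal_def)
qed

text \<open>Multiplying a linear relation by the matrix of \<open>w\<close> gives the relation shifted by \<open>w\<close>.\<close>

lemma combination_shift:
  assumes "u \<in> Z" "w \<in> Z" "S \<subseteq> Z" "E u = combination c S"
  shows "E (u + w) = (\<Sum>v\<in>S. (\<lambda>x. c v * E (v + w) x))"
proof (rule ext)
  fix x :: "nat \<times> nat"
  obtain p q where x: "x = (p, q)" by (cases x)
  let ?A = "mat_monomial n D M"
  have entry: "E (t + w) (p, q) = (\<Sum>k<D. E t (p, k) * E w (k, q))" if "t \<in> Z" "p < D" "q < D" for t
    using that carrier[OF that(1)] carrier[OF assms(2)]
    by (simp add: multiplicative[OF that(1) assms(2)] mat_entries_def scalar_prod_def lessThan_atLeast0)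
  show "E (u + w) x = (\<Sum>v\<in>S. (\<lambda>x. c v * E (v + w) x)) x"
  proof (cases "p < D \<and> q < D")
    case True
    then have pq: "p < D" "q < D" by simp_all
    have "E (u + w) (p, q) = (\<Sum>k<D. (\<Sum>v\<in>S. c v * E v (p, k)) * E w (k, q))"
      unfolding entry[OF assms(1) pq] assms(4) sum_fun_apply ..
    also have "\<dots> = (\<Sum>v\<in>S. \<Sum>k<D. c v * (E v (p, k) * E w (k, q)))"
      by (subst sum.swap) (simp add: sum_distrib_right mult.assoc)
    also have "\<dots> = (\<Sum>v\<in>S. c v * E (v + w) (p, q))"
      using assms(3) pq by (intro sum.cong) (auto simp: entry sum_distrib_left subset_iff)
    finally show ?thesis by (simp add: x sum_fun_apply)
  next
    case False
    then have "E t (p, q) = 0" for t by (auto simp: mat_entries_def)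
    then show ?thesis by (simp add: x sum_fun_apply)
  qed
qed

text \<open>
  The last clause says that every monomial is accounted for: it is a standard monomial found so
  far, a multiple of a leading monomial of the output, or a multiple of a monomial still in the
  list.
\<close>

definition invariant ::
  "(nat \<Rightarrow>\<^sub>0 nat) set \<times> (nat \<Rightarrow>\<^sub>0 nat) set \<times> (nat, 'k) mpoly set \<Rightarrow> bool" where
  "invariant = (\<lambda>(L, S, G). finite L \<and> finite S \<and> finite G \<and> L \<subseteq> Z \<and> S \<subseteq> Z \<and>
     (\<forall>v\<in>S. \<forall>l\<in>L. (v, l) \<in> r \<and> v \<noteq> l) \<and>
     inj_on E S \<and> entries.independent (E ` S) \<and>
     (\<forall>g\<in>G. g \<noteq> 0 \<and> g \<in> relation_ideal n D M) \<and>
     (\<forall>t\<in>Z. t \<in> S \<or> (\<exists>g\<in>G. \<exists>w\<in>Z. t = lead_monomial r g + w) \<or> (\<exists>l\<in>L. \<exists>w\<in>Z. t = l + w)))"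

lemma invariantD:
  assumes "invariant (L, S, G)"
  shows "finite L" "finite S" "finite G" "L \<subseteq> Z" "S \<subseteq> Z"
    and "\<And>v l. v \<in> S \<Longrightarrow> l \<in> L \<Longrightarrow> (v, l) \<in> r \<and> v \<noteq> l"
    and "inj_on E S" "entries.independent (E ` S)"
    and "\<And>g. g \<in> G \<Longrightarrow> g \<noteq> 0 \<and> g \<in> relation_ideal n D M"
    and "\<And>t. t \<in> Z \<Longrightarrow> t \<in> S \<or> (\<exists>g\<in>G. \<exists>w\<in>Z. t = lead_monomial r g + w) \<or>
      (\<exists>l\<in>L. \<exists>w\<in>Z. t = l + w)"
  using assms unfolding invariant_def prod.case by simp_all

lemma invariantI:
  assumes "finite L" "finite S" "finite G" "L \<subseteq> Z" "S \<subseteq> Z"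
    and "\<And>v l. v \<in> S \<Longrightarrow> l \<in> L \<Longrightarrow> (v, l) \<in> r \<and> v \<noteq> l"
    and "inj_on E S" "entries.independent (E ` S)"
    and "\<And>g. g \<in> G \<Longrightarrow> g \<noteq> 0 \<and> g \<in> relation_ideal n D M"
    and "\<And>t. t \<in> Z \<Longrightarrow> t \<in> S \<or> (\<exists>g\<in>G. \<exists>w\<in>Z. t = lead_monomial r g + w) \<or>
      (\<exists>l\<in>L. \<exists>w\<in>Z. t = l + w)"
  shows "invariant (L, S, G)"
  unfolding invariant_def prod.case using assms by simp

text \<open>At most \<open>D\<^sup>2\<close> matrices of size \<open>D\<close> are independent; this makes the loop terminate.\<close>

lemma card_standard_le:
  assumes "invariant (L, S, G)"
  shows "card S \<le> D * D"
proof -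
  let ?I = "(\<lambda>q x. if x = q then 1 else 0) ` ({..<D} \<times> {..<D}) :: (nat \<times> nat \<Rightarrow> 'k) set"
  have "E t \<in> entries.span ?I" for t
    by (rule in_span_of_indicators) (auto simp: mat_entries_def split: if_splits)
  then have "card (E ` S) \<le> card ?I"
    using invariantD(8)[OF assms] entries.independent_span_bound[of ?I "E ` S"] by auto
  also have "\<dots> \<le> card ({..<D} \<times> {..<D})" by (rule card_image_le) simp
  finally show ?thesis using invariantD(7)[OF assms] by (simp add: card_image)
qed

lemma in_span_iff_relation:
  assumes "finite S" "inj_on E S"
  shows "f \<in> entries.span (E ` S) \<longleftrightarrow> (\<exists>c. f = combination c S)"
proof
  assume "f \<in> entries.span (E ` S)"
  then obtain c where "f = (\<Sum>g\<in>E ` S. (\<lambda>x. c g * g x))"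
    using entries.span_finite[of "E ` S"] assms(1) by auto
  then have "f = combination (\<lambda>v. c (E v)) S" by (simp add: sum.reindex[OF assms(2)])
  then show "\<exists>c. f = combination c S" by (rule exI[of _ "\<lambda>v. c (E v)"])
next
  assume "\<exists>c. f = combination c S"
  then obtain c where f: "f = combination c S" ..
  show "f \<in> entries.span (E ` S)"
    unfolding f by (intro entries.span_sum entries.span_scale entries.span_base imageI)
qed

text \<open>
  The monomial \<open>u\<close> that is removed exceeds every standard monomial found so far and precedes all
  its own multiples. Hence a relation found at \<open>u\<close> has leading monomial \<open>u\<close>, and monomials that enter
  the list are larger than everything processed before.
\<close>

lemma fglm_step_invariant:
  assumes inv: "invariant (L, S, G)" and L: "L \<noteq> {}"
    and s': "fglm_step n r D M (L, S, G) = (L', S', G')"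
  shows "invariant (L', S', G')"
    and "card S' > card S \<or> S' = S \<and> card L' < card L"
proof -
  note fin = invariantD(1-3)[OF inv] and LZ = invariantD(4)[OF inv] and SZ = invariantD(5)[OF inv]
    and less = invariantD(6)[OF inv] and inj = invariantD(7)[OF inv] and indep = invariantD(8)[OF inv]
    and GK = invariantD(9)[OF inv] and cover = invariantD(10)[OF inv]
  define u where "u = (THE u. u \<in> L \<and> (\<forall>v\<in>L. (u, v) \<in> r))"
  have u: "u \<in> L" "\<And>v. v \<in> L \<Longrightarrow> (u, v) \<in> r"
    using theI'[OF least_exists[OF LZ L]] by (auto simp: u_def)
  have uZ: "u \<in> Z" using u(1) LZ by blast
  have uS: "u \<notin> S" using u(1) less by blast
  let ?div = "\<exists>g\<in>G. \<exists>w. u = lead_monomial r g + w"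
  let ?rel = "\<lambda>c. mat_monomial n D M u = mat_lincomb D c (mat_monomial n D M) S"
  have step_eq: "(L', S', G') =
      (if ?div then (L - {u}, S, G)
       else if \<exists>c. ?rel c then
         (L - {u}, S, insert (monom_poly u - (\<Sum>v\<in>S. Poly_Mapping.single v ((SOME c. ?rel c) v))) G)
       else (L - {u} \<union> (\<lambda>i. u + Poly_Mapping.single i 1) ` {1..n}, insert u S, G))"
    unfolding s'[symmetric] fglm_step_def prod.case Let_def u_def ..
  have cardL: "card (L - {u}) < card L"
    using fin(1) u(1) by (rule card_Diff1_less)
  have "invariant (L', S', G') \<and> (card S' > card S \<or> S' = S \<and> card L' < card L)"
  proof (cases ?div)
    case True
    then obtain g w where g: "g \<in> G" "u = lead_monomial r g + w" by blast
    have "w \<in> Z" using uZ g(2) by simp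
    have cover': "t \<in> S \<or> (\<exists>g\<in>G. \<exists>w\<in>Z. t = lead_monomial r g + w) \<or> (\<exists>l\<in>L - {u}. \<exists>w\<in>Z. t = l + w)"
      if "t \<in> Z" for t
      using cover[OF that]
    proof (elim disjE bexE)
      fix l w' assume l: "l \<in> L" "w' \<in> Z" "t = l + w'"
      show ?thesis
      proof (cases "l = u")
        case True
        then have "t = lead_monomial r g + (w + w')" using l g by (simp add: add.assoc)
        then show ?thesis using g(1) \<open>w \<in> Z\<close> l(2) by (metis z_add_iff)
      next
        case False
        with l show ?thesis by blast
      qed
    qed blast+
    have "invariant (L - {u}, S, G)"
      by (rule invariantI[OF _ fin(2,3) _ SZ less inj indep GK cover']) (use fin LZ in auto)
    then show ?thesis using step_eq True cardL by simp
  next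
    case nodiv: False
    show ?thesis
    proof (cases "\<exists>c. ?rel c")
      case True
      define c where "c = (SOME c. ?rel c)"
      have "?rel c" unfolding c_def by (rule someI_ex[OF True])
      then have rel: "E u = combination c S" by (simp add: relation_iff[OF uZ])
      define g where "g = monom_poly u - (\<Sum>v\<in>S. Poly_Mapping.single v (c v))"
      have lookup_g: "Poly_Mapping.lookup g t = (if t = u then 1 else if t \<in> S then - c t else 0)" for t
        using uS fin(2)
        by (auto simp: g_def lookup_minus lookup_sum lookup_single when_def sum.delta)
      have keys_g: "Poly_Mapping.keys g \<subseteq> insert u S"
        by (auto simp: in_keys_iff lookup_g split: if_splits)
      have u_g: "u \<in> Poly_Mapping.keys g" by (simp add: in_keys_iff lookup_g)
      have lead: "lead_monomial r g = u"
        using u_g keys_g less u(1) le_refl[OF uZ] by (intro lead_monomialI) blast+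
      have "combination (Poly_Mapping.lookup g) (Poly_Mapping.keys g) =
          combination (Poly_Mapping.lookup g) (insert u S)"
        using keys_g fin(2) by (intro sum.mono_neutral_left) (auto simp: in_keys_iff fun_eq_iff)
      also have "\<dots> = E u + combination (Poly_Mapping.lookup g) S"
        using uS fin(2) by (simp add: lookup_g)
      also have "combination (Poly_Mapping.lookup g) S = - combination c S"
        unfolding sum_negf[symmetric] using uS
        by (intro sum.cong) (auto simp: lookup_g fun_eq_iff)
      finally have "g \<in> relation_ideal n D M"
        using keys_g uZ SZ rel by (auto simp: relation_ideal_iff)
      moreover have "g \<noteq> 0" using u_g by auto
      ultimately have GK': "g' \<noteq> 0 \<and> g' \<in> relation_ideal n D M" if "g' \<in> insert g G" for g'
        using GK that by blast
      have cover': "t \<in> S \<or> (\<exists>g\<in>insert g G. \<exists>w\<in>Z. t = lead_monomial r g + w) \<or>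
          (\<exists>l\<in>L - {u}. \<exists>w\<in>Z. t = l + w)" if "t \<in> Z" for t
        using cover[OF that] lead by blast
      have "invariant (L - {u}, S, insert g G)"
        by (rule invariantI[OF _ fin(2) _ _ SZ less inj indep GK' cover']) (use fin LZ in auto)
      then show ?thesis using step_eq nodiv True cardL by (simp add: c_def g_def)
    next
      case norel: False
      let ?L = "L - {u} \<union> (\<lambda>i. u + Poly_Mapping.single i 1) ` {1..n}"
      have new: "E u \<notin> entries.span (E ` S)"
        unfolding in_span_iff_relation[OF fin(2) inj] using norel unfolding relation_iff[OF uZ] .
      then have "E u \<notin> E ` S" using entries.span_base[of "E u" "E ` S"] by argo
      with inj have inj': "inj_on E (insert u S)" using uS by (simp add: inj_on_insert)
      have indep': "entries.independent (E ` insert u S)"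
        using new indep by (simp add: entries.independent_insertI)
      have LZ': "?L \<subseteq> Z" using LZ uZ by auto
      have less': "(v, l) \<in> r \<and> v \<noteq> l" if v: "v \<in> insert u S" and l: "l \<in> ?L" for v l
      proof -
        have vu: "(v, u) \<in> r" using v less[OF _ u(1)] le_refl[OF uZ] by blast
        show ?thesis
        proof (cases "l \<in> L - {u}")
          case True
          then show ?thesis using v less u(2) by blast
        next
          case False
          then obtain i where i: "i \<in> {1..n}" "l = u + Poly_Mapping.single i 1"
            using l by blast
          then have ul: "(u, l) \<in> r" using le_add_right[OF uZ z_single] by simp
          moreover have "u \<noteq> l"
            using i(2) by (metis add_cancel_left_right keys_single keys_zero insert_not_empty one_neq_zero)
          ultimately show ?thesis using vu le_trans le_antisym by blast
        qed
      qed
      have cover': "t \<in> insert u S \<or> (\<exists>g\<in>G. \<exists>w\<in>Z. t = lead_monomial r g + w) \<or>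
          (\<exists>l\<in>?L. \<exists>w\<in>Z. t = l + w)" if "t \<in> Z" for t
        using cover[OF that]
      proof (elim disjE bexE)
        fix l w assume l: "l \<in> L" "w \<in> Z" "t = l + w"
        show ?thesis
        proof (cases "l = u \<and> w \<noteq> 0")
          case True
          then obtain i where i: "i \<in> Poly_Mapping.keys w"
            using poly_mapping_eqI[of w 0] by (auto simp: in_keys_iff)
          define w' where "w' = w - Poly_Mapping.single i 1"
          have w: "w = Poly_Mapping.single i 1 + w'" unfolding w'_def by (rule exponent_split[OF i])
          have "i \<in> {1..n}" using i l(2) by (auto simp: z_monomials_def)
          moreover have "t = (u + Poly_Mapping.single i 1) + w'"
            using l(3) True w by (metis add.assoc)
          moreover have "w' \<in> Z" using l(2) w by (metis z_add_iff)
          ultimately show ?thesis by blast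
        next
          case False
          with l show ?thesis by auto
        qed
      qed blast+
      have "invariant (?L, insert u S, G)"
        by (rule invariantI[OF _ _ fin(3) LZ' _ less' inj' indep' GK cover']) (use fin uZ SZ in auto)
      then show ?thesis using step_eq nodiv norel uS fin(2) by simp
    qed
  qed
  then show "invariant (L', S', G')" "card S' > card S \<or> S' = S \<and> card L' < card L" by auto
qed

lemma invariant_initial: "invariant ({0}, {}, {})"
  by (auto simp: invariant_def entries.independent_empty)

lemma fglm_terminates:
  obtains S G where "fglm n r D M = Some G" "invariant ({}, S, G)"
proof -
  let ?b = "\<lambda>(L, S, G). L \<noteq> {}" and ?c = "fglm_step n r D M" and ?s = "({0}, {}, {})"
  let ?R = "measures [\<lambda>(L, S, G). D * D - card S, \<lambda>(L, S, G). card L]"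
  have dec: "(?c s, s) \<in> ?R" if "invariant s \<and> ?b s" for s
  proof -
    obtain L S G where s: "s = (L, S, G)" by (cases s)
    obtain L' S' G' where s': "?c (L, S, G) = (L', S', G')" by (cases "?c (L, S, G)")
    have L: "L \<noteq> {}" "invariant (L, S, G)" using that s by auto
    have "card S' \<le> D * D" by (rule card_standard_le[OF fglm_step_invariant(1)[OF L(2,1) s']])
    then show ?thesis using fglm_step_invariant(2)[OF L(2,1) s'] by (auto simp: s s')
  qed
  have pres: "invariant (?c s)" if "invariant s" "?b s" for s
  proof -
    obtain L S G where s: "s = (L, S, G)" by (cases s)
    obtain L' S' G' where s': "?c (L, S, G) = (L', S', G')" by (cases "?c (L, S, G)")
    show ?thesis using fglm_step_invariant(1)[of L S G, OF _ _ s'] that by (simp add: s s')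
  qed
  have "\<exists>t. while_option ?b ?c ?s = Some t"
    by (rule wf_rel_while_option_Some[where R = ?R and P = invariant])
      (use dec pres invariant_initial in auto)
  then obtain t where t: "while_option ?b ?c ?s = Some t" ..
  obtain L S G where tt: "t = (L, S, G)" by (cases t)
  have "invariant t"
    by (rule while_option_rule[where P = invariant, OF pres t invariant_initial])
  moreover have "L = {}" using while_option_stop[OF t] by (simp add: tt)
  ultimately show thesis using that t by (simp add: fglm_def tt)
qed

lemma lead_matrix_combination:
  assumes p: "p \<in> relation_ideal n D M" "p \<noteq> 0"
  shows "\<exists>c. E (lead_monomial r p) =
    combination c (Poly_Mapping.keys p - {lead_monomial r p})"
proof -
  let ?u = "lead_monomial r p" and ?K = "Poly_Mapping.keys p"
  have K: "?K \<subseteq> Z" and zero: "combination (Poly_Mapping.lookup p) ?K = 0"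
    using p(1) by (auto simp: relation_ideal_iff)
  let ?k = "Poly_Mapping.lookup p ?u"
  have u: "?u \<in> ?K" by (rule lead_monomial(1)[OF p(2) K])
  then have k: "?k \<noteq> 0" by (simp add: in_keys_iff)
  have sum0: "?k * E ?u x + (\<Sum>v\<in>?K - {?u}. Poly_Mapping.lookup p v * E v x) = 0" for x
    using fun_cong[OF zero, of x] sum.remove[OF finite_keys u, of "\<lambda>v. Poly_Mapping.lookup p v * E v x"]
    by (simp add: sum_fun_apply)
  have "E ?u x = combination (\<lambda>v. - Poly_Mapping.lookup p v / ?k) (?K - {?u}) x" for x
  proof -
    have "E ?u x = - (\<Sum>v\<in>?K - {?u}. Poly_Mapping.lookup p v * E v x) / ?k"
      using sum0[of x] k by (simp add: field_simps add_eq_0_iff)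
    then show ?thesis by (simp add: sum_fun_apply sum_divide_distrib sum_negf)
  qed
  then have "E ?u = combination (\<lambda>v. - Poly_Mapping.lookup p v / ?k) (?K - {?u})" by (rule ext)
  then show ?thesis by (rule exI[of _ "\<lambda>v. - Poly_Mapping.lookup p v / ?k"])
qed

text \<open>
  Rewriting with the output reduces the matrix of every monomial to the matrices of standard
  monomials that are not larger.
\<close>

lemma span_of_standard:
  assumes inv: "invariant ({}, S, G)" and "s \<in> Z"
  shows "E s \<in> entries.span (E ` {v \<in> S. (v, s) \<in> r})"
  using assms(2)
proof (induction s rule: wf_induct_rule[OF wf_less])
  case (1 s)
  show ?case
  proof (cases "s \<in> S")
    case True
    then show ?thesis using le_refl[OF 1(2)] by (intro entries.span_base) blast
  next
    case False
    then obtain g w where g: "g \<in> G" "w \<in> Z" "s = lead_monomial r g + w"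
      using invariantD(10)[OF inv 1(2)] by blast
    let ?u = "lead_monomial r g" and ?K = "Poly_Mapping.keys g"
    have gK: "g \<in> relation_ideal n D M" "g \<noteq> 0" using invariantD(9)[OF inv g(1)] by blast+
    then have K: "?K \<subseteq> Z" by (simp add: relation_ideal_iff)
    obtain c where c: "E ?u = combination c (?K - {?u})" using lead_matrix_combination[OF gK] by blast
    have uZ: "?u \<in> Z" using 1(2) g(3) by simp
    have "E s = (\<Sum>v\<in>?K - {?u}. (\<lambda>x. c v * E (v + w) x))"
      unfolding g(3) by (rule combination_shift[OF uZ g(2) _ c]) (use K in blast)
    also have "\<dots> \<in> entries.span (E ` {v \<in> S. (v, s) \<in> r})"
    proof (intro entries.span_sum entries.span_scale)
      fix v assume v: "v \<in> ?K - {?u}"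
      then have vs: "(v + w, s) \<in> r"
        using le_add[OF lead_monomial(2)[OF gK(2) K] g(2)] g(3) by simp
      moreover have "v + w \<noteq> s" using v g(3) by simp
      ultimately have "E (v + w) \<in> entries.span (E ` {v' \<in> S. (v', v + w) \<in> r})"
        using 1(1) le_in by blast
      moreover have "E ` {v' \<in> S. (v', v + w) \<in> r} \<subseteq> E ` {v \<in> S. (v, s) \<in> r}"
        using vs le_trans by blast
      ultimately show "E (v + w) \<in> entries.span (E ` {v \<in> S. (v, s) \<in> r})"
        using entries.span_mono by blast
    qed
    finally show ?thesis .
  qed
qed

text \<open>
  If the leading monomial of a relation were standard, the relation would express its matrix by
  those of smaller monomials, hence by those of smaller standard monomials, which contradicts
  independence.
\<close>

lemma lead_monomial_divisible:
  assumes inv: "invariant ({}, S, G)" and p: "p \<in> relation_ideal n D M" "p \<noteq> 0"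
  obtains g w where "g \<in> G" "w \<in> Z" "lead_monomial r p = lead_monomial r g + w"
proof -
  let ?u = "lead_monomial r p"
  have K: "Poly_Mapping.keys p \<subseteq> Z" using p(1) by (simp add: relation_ideal_iff)
  have "?u \<notin> S"
  proof
    assume u: "?u \<in> S"
    obtain c where c: "E ?u = combination c (Poly_Mapping.keys p - {?u})"
      using lead_matrix_combination[OF p] by blast
    also have "\<dots> \<in> entries.span (E ` (S - {?u}))"
    proof (intro entries.span_sum entries.span_scale)
      fix v assume v: "v \<in> Poly_Mapping.keys p - {?u}"
      have "(v, ?u) \<in> r" "v \<noteq> ?u" using v lead_monomial(2)[OF p(2) K] by auto
      then have "E ` {v' \<in> S. (v', v) \<in> r} \<subseteq> E ` (S - {?u})"
        using le_antisym by blast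
      then show "E v \<in> entries.span (E ` (S - {?u}))"
        using span_of_standard[OF inv, of v] entries.span_mono v K by blast
    qed
    finally have "E ?u \<in> entries.span (E ` S - {E ?u})"
      using inj_on_image_set_diff[OF invariantD(7)[OF inv], of S "{?u}"] u by simp
    then show False using invariantD(8)[OF inv] u by (auto simp: entries.dependent_def)
  qed
  moreover have "?u \<in> Z" using lead_monomial(1)[OF p(2) K] K by blast
  ultimately show thesis using invariantD(10)[OF inv, of ?u] that by blast
qed

lemma fglm_correct:
  "\<exists>G. fglm n r D M = Some G \<and> groebner_basis n r G (relation_ideal n D M)"
proof -
  obtain S G where fg: "fglm n r D M = Some G" and inv: "invariant ({}, S, G)" by (rule fglm_terminates)
  let ?J = "relation_ideal n D M"
  let ?lead = "\<lambda>F :: (nat, 'k) mpoly set. {monom_poly (lead_monomial r f) | f. f \<in> F \<and> f \<noteq> 0}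
    :: (nat, 'k) mpoly set"
  have GJ: "G \<subseteq> ?J" using invariantD(9)[OF inv] by blast
  have leadZ: "lead_monomial r f \<in> Z" if "f \<in> ?J" "f \<noteq> 0" for f
    using lead_monomial(1)[OF that(2)] that(1) by (auto simp: relation_ideal_iff)
  have sub: "?lead F \<subseteq> carrier (poly_ring {1..n})" if "F \<subseteq> ?J" for F
    using leadZ that by (auto simp: z_monomials_def)
  interpret LG: ideal "lead_ideal n r G" "poly_ring {1..n}"
    unfolding lead_ideal_def z_ring_def by (rule poly_ring.genideal_ideal[OF sub[OF GJ]])
  have "?lead ?J \<subseteq> lead_ideal n r G"
  proof
    fix p assume "p \<in> ?lead ?J"
    then obtain f where f: "f \<in> ?J" "f \<noteq> 0" and p: "p = monom_poly (lead_monomial r f)" by blast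
    obtain g w where g: "g \<in> G" "w \<in> Z" "lead_monomial r f = lead_monomial r g + w"
      using lead_monomial_divisible[OF inv f] .
    have "monom_poly (lead_monomial r g) \<in> lead_ideal n r G"
      unfolding lead_ideal_def z_ring_def
      using poly_ring.genideal_self[OF sub[OF GJ]] g(1) invariantD(9)[OF inv g(1)] by blast
    then have "monom_poly (lead_monomial r g) * monom_poly w \<in> lead_ideal n r G"
      using LG.I_r_closed[of "monom_poly (lead_monomial r g)" "monom_poly w"] g(2)
      by (simp add: z_monomials_def)
    then show "p \<in> lead_ideal n r G" by (simp add: p g(3) mult_single)
  qed
  then have "lead_ideal n r ?J \<subseteq> lead_ideal n r G"
    unfolding lead_ideal_def[of n r ?J] z_ring_def
    by (rule poly_ring.genideal_minimal[OF LG.is_ideal])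
  moreover have "lead_ideal n r G \<subseteq> lead_ideal n r ?J"
  proof -
    have "?lead G \<subseteq> ?lead ?J" using GJ by blast
    then have leadG: "?lead G \<subseteq> lead_ideal n r ?J"
      unfolding lead_ideal_def z_ring_def
      using poly_ring.genideal_self[OF sub[OF order_refl]] by blast
    have "ideal (lead_ideal n r ?J) (poly_ring {1..n})"
      unfolding lead_ideal_def z_ring_def by (rule poly_ring.genideal_ideal[OF sub[OF order_refl]])
    then show ?thesis
      unfolding lead_ideal_def[of n r G] z_ring_def using leadG by (rule poly_ring.genideal_minimal)
  qed
  ultimately have "groebner_basis n r G ?J"
    using GJ invariantD(3)[OF inv] by (simp add: groebner_basis_def)
  with fg show ?thesis by blast
qed

end

section \<open>Recovering the dehomogenized ideal\<close>

theorem corollary3p7: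
  fixes n m a b :: nat
    and I :: "(var, 'k::field) mpoly set"
    and B :: "(var, 'k) mpoly set list"
    and r :: "(nat \<Rightarrow>\<^sub>0 nat) rel"
  assumes "bihomogeneous_ideal n m I"
    and "admissible n m I a b"
    and "admissible_linear_form n m I a b (var_poly (X 0))"
    and "distinct B" and "vectorspace.basis class_ring (quot_part n m I a b) (set B)"
    and "monomial_order n r"
  shows "\<exists>G. fglm n r (length B) (mult_matrix n m I a b B) = Some G \<and>
             groebner_basis n r G (affine_ideal n m I b)"
proof -
  interpret bi_ideal n m I
    using assms(1) by (simp add: bi_ideal_def bihomogeneous_ideal_def)
  interpret V: vectorspace class_ring "piece a b" by (rule piece_vectorspace)
  have "V.fin_dim" using assms(5) by (auto simp: V.fin_dim_def V.basis_def)
  then interpret admissible_ideal n m I a b by (rule admissible_idealI[OF assms(1-3)])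
  interpret admissible_basis n m I a b B
    using assms(4,5) by unfold_locales
  interpret fglm_input n r D M
    using assms(6) A_add A_carrier by unfold_locales
  show ?thesis
    using fglm_correct unfolding relation_ideal_eq_affine_ideal .
qed

end
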